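(* Let $n\ge 4$ and $3\le k\le n$. The rank of the $(k-1)$-st homology group of $C_{n,k}$ is given by $$\operatorname{rank} H_{k-1}(C_{n,k}) = \sum_{i=k}^{n} (-1)^{k+i}\, 2^{n-i}\binom{n}{i}.$$
   Context: Let $\mathbf{n} = \{1,\ldots,n\}$. $\Psi^+_n$ is the set of points of $\{\pm1\}^n\subset\mathbb{R}^n$ with an even number of negative coordinates. For $\mathbf{v}\in\Psi^+_n$ and $S\subseteq\mathbf{n}$, $L(\mathbf{v},S)$ is the set of points of $\Psi^+_n$ agreeing with $\mathbf{v}$ in the $i$-th coordinate for every $i\notin S$. $\Pi(V)$ denotes the convex hull of $V$. The half cube is $h\gamma_n = \Pi(\Psi^+_n) = \Pi(L(\mathbf{v},\mathbf{n}))$. It is a regular CW complex whose set of cells $E$ consists of the vertices of $h\gamma_n$, the relative interiors of all $k$-dimensional faces of $h\gamma_n$ for $0<k<n$, and the interior of $h\gamma_n$. For $k\ge 3$, $E(k)\subseteq E$ consists of all cells $e\in E$ except those whose closure is $\Pi(L(\mathbf{v},S))$ for some $\mathbf{v}\in\Psi^+_n$ and some $S\subseteq\mathbf{n}$ with $|S|\ge k$ (the "half cube shaped" faces of dimension at least $k$, including $h\gamma_n$ itself when $k \le n$). For $3\le k\le n$, $C_{n,k}$ is the subcomplex of $h\gamma_n$ with set of cells $E(k)$; its underlying space is $\bigcup_{e\in E(k)} e$. Homology is taken with integer coefficients. *)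

theory Defs
  imports "HOL-Analysis.Analysis" "HOL-Homology.Homology"
begin

definition even_sign_vectors :: "(real ^ 'n) set" where
  "even_sign_vectors =
    {x. (\<forall>i. x $ i \<in> {1, -1}) \<and> even (card {i. x $ i < 0})}"

definition L_set :: "real ^ 'n \<Rightarrow> 'n set \<Rightarrow> (real ^ 'n) set" where
  "L_set v S = {x \<in> even_sign_vectors. \<forall>i. i \<notin> S \<longrightarrow> x $ i = v $ i}"

definition half_cube :: "(real ^ 'n) set" where
  "half_cube = convex hull even_sign_vectors"

definition half_cube_cells :: "(real ^ 'n) set set" where
  "half_cube_cells =
     {{x} | x. x extreme_point_of half_cube}
   \<union> {rel_interior F | F. F face_of half_cube \<and> 0 < aff_dim F \<and> aff_dim F < int CARD('n)}
   \<union> {interior half_cube}"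

definition half_cube_subcells :: "nat \<Rightarrow> (real ^ 'n) set set" where
  "half_cube_subcells k =
     {e \<in> half_cube_cells.
        \<not> (\<exists>v S. v \<in> even_sign_vectors \<and> card S \<ge> k \<and> closure e = convex hull (L_set v S))}"

definition half_cube_complex :: "nat \<Rightarrow> (real ^ 'n) set" where
  "half_cube_complex k = \<Union> (half_cube_subcells k)"

definition integrally_independent :: "('a, 'b) monoid_scheme \<Rightarrow> 'a set \<Rightarrow> bool" where
  "integrally_independent G B \<longleftrightarrow>
     finite B \<and> B \<subseteq> carrier G \<and>
     (\<forall>c :: 'a \<Rightarrow> int.
        finprod G (\<lambda>b. b [^]\<^bsub>G\<^esub> c b) B = \<one>\<^bsub>G\<^esub> \<longrightarrow> (\<forall>b\<in>B. c b = 0))"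

text \<open>The rank of an abelian group (written multiplicatively) is the largest size of a finite
  family that is linearly independent over the integers. It takes values in the extended naturals
  so that groups of infinite rank are not confused with groups of finite rank.\<close>

definition abelian_group_rank :: "('a, 'b) monoid_scheme \<Rightarrow> enat" where
  "abelian_group_rank G = (SUP B \<in> Collect (integrally_independent G). enat (card B))"

end

theory Submission
  imports Defs
begin

text \<open>Call a vertex of the cube \<open>[-1, 1]\<^sup>n\<close> even or odd according to its number of negative coordinates.
  The half cube arises from the cube by cutting off every odd vertex \<open>w\<close> along the hyperplane
  \<open>w \<bullet> x = n - 2\<close> through its neighbours.  This leads to a description of the complex by inequalities
  (\<open>mem_half_cube_complex_iff\<close>): it consists of the points of the half cube that lie on one of the cutting
  hyperplanes or have fewer than \<open>k\<close> coordinates strictly between \<open>-1\<close> and \<open>1\<close>.  Except for the filled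
  cuts, this is the \<open>(k-1)\<close>-skeleton of the cube with its odd corners cut off.  Near an odd corner,
  the skeleton of the cube is a cone, which is contractible; in the complex this cone is replaced by the
  simplex that fills the cut, which is contractible too.  So both spaces should have the same homology.

  It is convenient to compare the complex with an open set instead of the skeleton: with the set \<open>W\<close> of all
  points of \<open>\<real>\<^sup>n\<close> that have fewer than \<open>k\<close> zero coordinates.  The complex is contained in \<open>W\<close>, and
  the inclusion has an explicit homotopy inverse: scale, clamp to the cube, cut the corners
  (\<open>half_cube_complex_homotopy_equivalent\<close>).

  The homology of \<open>W\<close> relative to \<open>\<real>\<^sup>n\<close> is computed by admitting one coordinate at a time to the count
  of zeros.  Each new coordinate multiplies a pair of open sets by \<open>(\<real>, \<real> - {0})\<close>, which shifts its
  homology by one degree (\<open>relative_homology_group_suspension\<close>).  All groups involved live in a single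
  degree, so the long exact sequences of triples decompose into short ones
  (\<open>relative_homology_few_zeros\<close>).  Since rank is additive on short exact sequences
  (\<open>abelian_group_rank_extension\<close>), the ranks \<open>r(m, k)\<close> satisfy \<open>r(m+1, k+1) = 2 r(m, k+1) + r(m, k)\<close>,
  a recurrence that the alternating sum satisfies by Pascal's rule (\<open>skeleton_rank_eq\<close>).\<close>

section \<open>The rank of an abelian group\<close>

text \<open>Families rather than sets: a union of two bases, or the elements chosen for a set of indices, then needs
no argument that the members are distinct, since independence itself forces injectivity.\<close>

definition independent_family :: "('a, 'b) monoid_scheme \<Rightarrow> ('i \<Rightarrow> 'a) \<Rightarrow> 'i set \<Rightarrow> bool" where
  "independent_family G b I \<longleftrightarrow>
     finite I \<and> b \<in> I \<rightarrow> carrier G \<and>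
     (\<forall>c :: 'i \<Rightarrow> int. finprod G (\<lambda>i. b i [^]\<^bsub>G\<^esub> c i) I = \<one>\<^bsub>G\<^esub> \<longrightarrow> (\<forall>i\<in>I. c i = 0))"

lemma independent_familyD:
  assumes "independent_family G b I"
    and "finprod G (\<lambda>i. b i [^]\<^bsub>G\<^esub> (c i :: int)) I = \<one>\<^bsub>G\<^esub>" and "i \<in> I"
  shows "c i = 0"
  using assms by (auto simp: independent_family_def)

lemma integrally_independentD:
  assumes "integrally_independent G B"
    and "finprod G (\<lambda>b. b [^]\<^bsub>G\<^esub> (c b :: int)) B = \<one>\<^bsub>G\<^esub>" and "b \<in> B"
  shows "c b = 0"
  using assms by (auto simp: integrally_independent_def)

lemma integrally_independent_iff_family:
  "integrally_independent G B \<longleftrightarrow> independent_family G (\<lambda>b. b) B"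
  by (auto simp: integrally_independent_def independent_family_def)

text \<open>A repeated member \<open>b i = b j\<close> would give the nontrivial relation with coefficients \<open>1\<close> and \<open>-1\<close>.\<close>

lemma (in comm_group) inj_on_independent_family:
  assumes "independent_family G b I"
  shows "inj_on b I"
proof (rule inj_onI, rule ccontr)
  fix i j assume ij: "i \<in> I" "j \<in> I" "b i = b j" "i \<noteq> j"
  have fin: "finite I" and b: "b \<in> I \<rightarrow> carrier G"
    using assms by (auto simp: independent_family_def)
  define c :: "_ \<Rightarrow> int" where "c = (\<lambda>_. 0)(i := 1, j := -1)"
  have I: "I = insert i (insert j (I - {i, j}))"
    using ij by auto
  have 1: "finprod G (\<lambda>i. b i [^] c i) (I - {i, j}) = \<one>"
    by (rule finprod_one_eqI) (auto simp: c_def)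
  have "finprod G (\<lambda>i. b i [^] c i) I = b i [^] c i \<otimes> (b j [^] c j \<otimes> finprod G (\<lambda>i. b i [^] c i) (I - {i, j}))"
    using fin b ij by (subst I) (simp add: Pi_iff)
  also have "\<dots> = \<one>"
    using ij b by (subst 1) (auto simp: c_def Pi_iff int_pow_neg)
  finally have "c i = 0"
    using independent_familyD[OF assms] ij by blast
  then show False
    using ij by (simp add: c_def)
qed

lemma (in comm_group) integrally_independent_image:
  assumes "independent_family G b I"
  shows "integrally_independent G (b ` I)"
  unfolding integrally_independent_def
proof (intro conjI allI impI)
  have fin: "finite I" and b: "b \<in> I \<rightarrow> carrier G"
    using assms by (auto simp: independent_family_def)
  then show "finite (b ` I)" "b ` I \<subseteq> carrier G"
    by auto
  fix c :: "'a \<Rightarrow> int"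
  assume "finprod G (\<lambda>b. b [^] c b) (b ` I) = \<one>"
  then have "finprod G (\<lambda>i. b i [^] c (b i)) I = \<one>"
    using b inj_on_independent_family[OF assms] by (subst (asm) finprod_reindex) auto
  then show "\<forall>x\<in>b ` I. c x = 0"
    using independent_familyD[OF assms, of "\<lambda>i. c (b i)"] by blast
qed

text \<open>A finite supremum of natural numbers is attained, so a finite rank is witnessed by a largest
independent set.\<close>

lemma abelian_group_rank_eq_enat_iff:
  "abelian_group_rank G = enat r \<longleftrightarrow>
     (\<exists>B. integrally_independent G B \<and> card B = r) \<and>
     (\<forall>B. integrally_independent G B \<longrightarrow> card B \<le> r)"
proof (intro iffI conjI allI impI)
  assume r: "abelian_group_rank G = enat r"
  show le: "card B \<le> r" if "integrally_independent G B" for B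
    using r that SUP_upper[of B "Collect (integrally_independent G)" "\<lambda>B. enat (card B)"]
    by (simp add: abelian_group_rank_def)
  have "integrally_independent G {}"
    by (simp add: integrally_independent_def)
  then have ne: "(\<lambda>B. enat (card B)) ` Collect (integrally_independent G) \<noteq> {}"
    by blast
  have "(\<lambda>B. enat (card B)) ` Collect (integrally_independent G) \<subseteq> enat ` {..r}"
    using le by auto
  then have fin: "finite ((\<lambda>B. enat (card B)) ` Collect (integrally_independent G))"
    by (rule finite_subset) simp
  have "Sup ((\<lambda>B. enat (card B)) ` Collect (integrally_independent G))
      \<in> (\<lambda>B. enat (card B)) ` Collect (integrally_independent G)"
    using Max_in[OF fin ne] fin ne unfolding Sup_enat_def by presburger
  then show "\<exists>B. integrally_independent G B \<and> card B = r"
    using r by (auto simp: abelian_group_rank_def)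
next
  assume *: "(\<exists>B. integrally_independent G B \<and> card B = r) \<and>
     (\<forall>B. integrally_independent G B \<longrightarrow> card B \<le> r)"
  then obtain B where B: "integrally_independent G B" "card B = r" by blast
  show "abelian_group_rank G = enat r"
    unfolding abelian_group_rank_def
  proof (rule antisym)
    show "(SUP B\<in>Collect (integrally_independent G). enat (card B)) \<le> enat r"
      using * by (intro SUP_least) auto
    show "enat r \<le> (SUP B\<in>Collect (integrally_independent G). enat (card B))"
      using B by (intro SUP_upper2[of B]) auto
  qed
qed

lemma (in comm_group) abelian_group_rank_eqI:
  assumes "\<And>B. integrally_independent G B \<Longrightarrow> card B \<le> r"
    and "independent_family G b I" and "card I = r"
  shows "abelian_group_rank G = enat r"
  using assms integrally_independent_image[OF assms(2)]
    card_image[OF inj_on_independent_family[OF assms(2)]]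
  unfolding abelian_group_rank_eq_enat_iff by metis

lemma card_independent_family_le_rank:
  assumes "comm_group G" "abelian_group_rank G = enat r" "independent_family G b I"
  shows "card I \<le> r"
  using assms comm_group.integrally_independent_image[OF assms(1,3)]
    card_image[OF comm_group.inj_on_independent_family[OF assms(1,3)]]
  unfolding abelian_group_rank_eq_enat_iff by metis

lemma hom_finprod_int_pow:
  assumes "comm_group G" "comm_group H" "h \<in> hom G H" "b \<in> I \<rightarrow> carrier G"
  shows "h (finprod G (\<lambda>i. b i [^]\<^bsub>G\<^esub> (c i :: int)) I) = finprod H (\<lambda>i. h (b i) [^]\<^bsub>H\<^esub> c i) I"
proof -
  interpret G: comm_group G by fact
  interpret H: comm_group H by fact
  interpret h: group_hom G H h
    using assms by (simp add: group_hom_def group_hom_axioms_def)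
  show ?thesis
    using assms(4)
  proof (induction I rule: infinite_finite_induct)
    case (insert i I)
    then have "b i \<in> carrier G" "b \<in> I \<rightarrow> carrier G" by auto
    with insert show ?case
      by (subst G.finprod_insert; (subst H.finprod_insert)?)
         (auto simp: h.hom_int_pow Pi_iff)
  qed auto
qed

lemma (in comm_group) finprod_int_pow_swap:
  assumes "finite I" "finite J" "b \<in> J \<rightarrow> carrier G"
  shows "finprod G (\<lambda>i. finprod G (\<lambda>j. b j [^] (c i j :: int)) J [^] (d i :: int)) I
       = finprod G (\<lambda>j. b j [^] (\<Sum>i\<in>I. c i j * d i)) J"
  using assms(1)
proof (induction I)
  case empty
  then show ?case
    by (simp add: finprod_one_eqI)
next
  case (insert i I)
  have pow: "finprod G (\<lambda>j. b j [^] (c i j)) J [^] d i = finprod G (\<lambda>j. b j [^] (c i j * d i)) J"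
    using assms(2,3)
  proof (induction J)
    case (insert j J)
    then have "b j \<in> carrier G" "b \<in> J \<rightarrow> carrier G" by auto
    with insert show ?case
      by (subst (1 2) finprod_insert) (auto simp: int_pow_distrib int_pow_pow Pi_iff)
  qed auto
  have cl: "finprod G (\<lambda>j. b j [^] (c i j)) J \<in> carrier G" for i
    using assms by (intro finprod_closed) auto
  have "finprod G (\<lambda>i. finprod G (\<lambda>j. b j [^] (c i j)) J [^] (d i)) (insert i I)
     = finprod G (\<lambda>j. b j [^] (c i j * d i)) J \<otimes> finprod G (\<lambda>j. b j [^] (\<Sum>i\<in>I. c i j * d i)) J"
    using insert cl by (subst finprod_insert) (auto simp flip: pow)
  also have "\<dots> = finprod G (\<lambda>j. b j [^] (c i j * d i) \<otimes> b j [^] (\<Sum>i\<in>I. c i j * d i)) J"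
    using assms by (subst finprod_multf) auto
  also have "\<dots> = finprod G (\<lambda>j. b j [^] (\<Sum>i\<in>insert i I. c i j * d i)) J"
    using assms insert by (intro finprod_cong') (auto simp: int_pow_mult Pi_iff)
  finally show ?case .
qed

text \<open>Rank is additive on extensions, without any splitting.  Lower bound: independent elements of the
subgroup together with lifts of independent elements of the quotient are independent.  Upper bound:
in an independent set \<open>B\<close> of the middle group pick a subset \<open>B'\<close> that is maximal among those with
independent image in the quotient.  By maximality every \<open>b \<in> B - B'\<close> has a nonzero multiple which
becomes, after a combination of elements of \<open>B'\<close> is added, an element of the kernel, and these kernel
elements are again independent, because \<open>b\<close> occurs in no other of them.\<close>

lemma abelian_group_rank_extension:
  assumes G: "comm_group A" "comm_group G" "comm_group C"
    and f: "f \<in> hom A G" "inj_on f (carrier A)"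
    and g: "g \<in> hom G C" "g ` carrier G = carrier C"
    and ex: "kernel G C g = f ` carrier A"
    and ra: "abelian_group_rank A = enat a" and rc: "abelian_group_rank C = enat c"
  shows "abelian_group_rank G = enat (a + c)"
proof -
  interpret A: comm_group A by fact
  interpret G: comm_group G by fact
  interpret C: comm_group C by fact
  interpret f: group_hom A G f
    using f by (simp add: group_hom_def group_hom_axioms_def)
  interpret g: group_hom G C g
    using g by (simp add: group_hom_def group_hom_axioms_def)
  obtain BA where BA: "integrally_independent A BA" "card BA = a"
    using ra abelian_group_rank_eq_enat_iff by metis
  obtain BC where BC: "integrally_independent C BC" "card BC = c"
    using rc abelian_group_rank_eq_enat_iff by metis
  have BA': "finite BA" "BA \<subseteq> carrier A" and BC': "finite BC" "BC \<subseteq> carrier C"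
    using BA BC by (auto simp: integrally_independent_def)
  obtain s where s: "\<And>x. x \<in> carrier C \<Longrightarrow> s x \<in> carrier G" "\<And>x. x \<in> carrier C \<Longrightarrow> g (s x) = x"
    using g(2) unfolding image_iff set_eq_iff by metis
  define b where "b = case_sum f s"
  have bcl: "b \<in> BA <+> BC \<rightarrow> carrier G"
    using BA' BC' s by (auto simp: b_def)
  show ?thesis
  proof (rule G.abelian_group_rank_eqI)
    fix B assume "integrally_independent G B"
    then have B: "independent_family G (\<lambda>b. b) B" "finite B" "B \<subseteq> carrier G"
      by (auto simp: integrally_independent_iff_family independent_family_def)
    define P where "P = {B'. B' \<subseteq> B \<and> independent_family C g B'}"
    have "finite P" "{} \<in> P"
      using B by (auto simp: P_def independent_family_def)
    then obtain B' where B': "B' \<in> P" and max: "\<And>B''. B'' \<in> P \<Longrightarrow> B' \<subseteq> B'' \<Longrightarrow> B' = B''"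
      using finite_has_maximal[of P] by (metis empty_iff)
    have B'sub: "B' \<subseteq> B" and B'ind: "independent_family C g B'"
      using B' by (auto simp: P_def)
    have B'fin: "finite B'" "B' \<subseteq> carrier G"
      using B'sub B finite_subset by auto
    have "\<exists>k. k b \<noteq> 0 \<and> (\<forall>x. x \<notin> insert b B' \<longrightarrow> k x = 0) \<and>
            g (finprod G (\<lambda>x. x [^]\<^bsub>G\<^esub> (k x :: int)) B) = \<one>\<^bsub>C\<^esub>" if b: "b \<in> B - B'" for b
    proof -
      have "insert b B' \<notin> P"
        using max[of "insert b B'"] b by auto
      then have "\<not> independent_family C g (insert b B')"
        using b B'sub by (auto simp: P_def)
      moreover have "finite (insert b B')" "g \<in> insert b B' \<rightarrow> carrier C"
        using B'fin b B by auto
      ultimately obtain k :: "_ \<Rightarrow> int" where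
        k: "finprod C (\<lambda>i. g i [^]\<^bsub>C\<^esub> k i) (insert b B') = \<one>\<^bsub>C\<^esub>" "\<exists>i\<in>insert b B'. k i \<noteq> 0"
        unfolding independent_family_def by blast
      have "k b \<noteq> 0"
      proof
        assume 0: "k b = 0"
        then have "finprod C (\<lambda>i. g i [^]\<^bsub>C\<^esub> k i) B' = \<one>\<^bsub>C\<^esub>"
          using k(1) b B'fin B C.finprod_closed[of "\<lambda>i. g i [^]\<^bsub>C\<^esub> k i" B']
          by (subst (asm) C.finprod_insert) (auto simp: Pi_iff subset_iff)
        then show False
          using independent_familyD[OF B'ind] k(2) 0 by blast
      qed
      moreover define k' where "k' x = (if x \<in> insert b B' then k x else 0)" for x
      moreover have "finprod C (\<lambda>i. g i [^]\<^bsub>C\<^esub> k' i) B = finprod C (\<lambda>i. g i [^]\<^bsub>C\<^esub> k i) (insert b B')"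
        using b B'sub B by (intro C.finprod_mono_neutral_cong_right) (auto simp: k'_def)
      ultimately show ?thesis
        using k(1) B hom_finprod_int_pow[OF G(2,3) g(1), of "\<lambda>x. x" B k']
        by (intro exI[of _ k']) (auto simp: Pi_iff subset_iff)
    qed
    then obtain k :: "_ \<Rightarrow> _ \<Rightarrow> int" where
      k: "\<And>b. b \<in> B - B' \<Longrightarrow> k b b \<noteq> 0" "\<And>b x. b \<in> B - B' \<Longrightarrow> x \<notin> insert b B' \<Longrightarrow> k b x = 0"
         "\<And>b. b \<in> B - B' \<Longrightarrow> g (finprod G (\<lambda>x. x [^]\<^bsub>G\<^esub> k b x) B) = \<one>\<^bsub>C\<^esub>"
      by metis
    have "finprod G (\<lambda>x. x [^]\<^bsub>G\<^esub> k b x) B \<in> f ` carrier A" if "b \<in> B - B'" for b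
      using k(3)[OF that] B unfolding ex[symmetric] kernel_def by (auto intro!: G.finprod_closed)
    then obtain e where e: "\<And>b. b \<in> B - B' \<Longrightarrow> e b \<in> carrier A"
        "\<And>b. b \<in> B - B' \<Longrightarrow> f (e b) = finprod G (\<lambda>x. x [^]\<^bsub>G\<^esub> k b x) B"
      unfolding image_iff by metis
    have "independent_family A e (B - B')"
      unfolding independent_family_def
    proof (intro conjI allI impI ballI)
      fix d :: "_ \<Rightarrow> int" and b
      assume d: "finprod A (\<lambda>i. e i [^]\<^bsub>A\<^esub> d i) (B - B') = \<one>\<^bsub>A\<^esub>" and b: "b \<in> B - B'"
      have "\<one>\<^bsub>G\<^esub> = finprod G (\<lambda>i. f (e i) [^]\<^bsub>G\<^esub> d i) (B - B')"
        using e d hom_finprod_int_pow[OF G(1,2) f(1), of e "B - B'" d] by auto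
      also have "\<dots> = finprod G (\<lambda>i. finprod G (\<lambda>x. x [^]\<^bsub>G\<^esub> k i x) B [^]\<^bsub>G\<^esub> d i) (B - B')"
        using e B by (intro G.finprod_cong') (auto intro!: G.finprod_closed G.int_pow_closed)
      also have "\<dots> = finprod G (\<lambda>x. x [^]\<^bsub>G\<^esub> (\<Sum>i\<in>B - B'. k i x * d i)) B"
        using B by (intro G.finprod_int_pow_swap) auto
      \<comment> \<open>Only the relation belonging to \<open>b\<close> itself involves \<open>b\<close>, so the coefficient collapses to one term.\<close>
      finally have "(\<Sum>i\<in>B - B'. k i b * d i) = 0"
        using independent_familyD[OF B(1), of "\<lambda>x. \<Sum>i\<in>B - B'. k i x * d i"] b by auto
      moreover have "(\<Sum>i\<in>B - B'. k i b * d i) = (\<Sum>i\<in>{b}. k i b * d i)"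
        using b B k(2) by (intro sum.mono_neutral_right) auto
      ultimately show "d b = 0"
        using k(1)[OF b] by simp
    qed (use B e in auto)
    then have "card (B - B') \<le> a"
      by (rule card_independent_family_le_rank[OF G(1) ra])
    moreover have "card B' \<le> c"
      by (rule card_independent_family_le_rank[OF G(3) rc B'ind])
    ultimately show "card B \<le> a + c"
      using card_Diff_subset[OF B'fin(1) B'sub] by linarith
  next
    show "card (BA <+> BC) = a + c"
      using BA BC BA' BC' by (simp add: card_Plus)
    show "independent_family G b (BA <+> BC)"
      unfolding independent_family_def
    proof (intro conjI allI impI)
      fix d :: "_ \<Rightarrow> int"
      assume d: "finprod G (\<lambda>i. b i [^]\<^bsub>G\<^esub> d i) (BA <+> BC) = \<one>\<^bsub>G\<^esub>"
      have "finprod G (\<lambda>i. b i [^]\<^bsub>G\<^esub> d i) (BA <+> BC)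
          = finprod G (\<lambda>i. b i [^]\<^bsub>G\<^esub> d i) (Inl ` BA) \<otimes>\<^bsub>G\<^esub> finprod G (\<lambda>i. b i [^]\<^bsub>G\<^esub> d i) (Inr ` BC)"
        unfolding Plus_def using bcl BA' BC' by (intro G.finprod_Un_disjoint) auto
      also have "finprod G (\<lambda>i. b i [^]\<^bsub>G\<^esub> d i) (Inl ` BA) = finprod G (\<lambda>x. f x [^]\<^bsub>G\<^esub> d (Inl x)) BA"
        using BA' by (subst G.finprod_reindex) (auto simp: b_def)
      also have "\<dots> = f (finprod A (\<lambda>x. x [^]\<^bsub>A\<^esub> d (Inl x)) BA)"
        using BA' by (subst hom_finprod_int_pow[OF G(1,2) f(1)]) auto
      also have "finprod G (\<lambda>i. b i [^]\<^bsub>G\<^esub> d i) (Inr ` BC) = finprod G (\<lambda>x. s x [^]\<^bsub>G\<^esub> d (Inr x)) BC"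
        using BC' s by (subst G.finprod_reindex) (auto simp: b_def)
      finally have eq: "f (finprod A (\<lambda>x. x [^]\<^bsub>A\<^esub> d (Inl x)) BA) \<otimes>\<^bsub>G\<^esub> finprod G (\<lambda>x. s x [^]\<^bsub>G\<^esub> d (Inr x)) BC = \<one>\<^bsub>G\<^esub>"
        using d by simp
      have cl: "finprod A (\<lambda>x. x [^]\<^bsub>A\<^esub> d (Inl x)) BA \<in> carrier A"
               "finprod G (\<lambda>x. s x [^]\<^bsub>G\<^esub> d (Inr x)) BC \<in> carrier G"
        using BA' BC' s by (auto intro!: A.finprod_closed G.finprod_closed)
      then have "f (finprod A (\<lambda>x. x [^]\<^bsub>A\<^esub> d (Inl x)) BA) \<in> kernel G C g"
        using ex by blast
      then have "g (f (finprod A (\<lambda>x. x [^]\<^bsub>A\<^esub> d (Inl x)) BA)) = \<one>\<^bsub>C\<^esub>"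
        by (simp add: kernel_def)
      with eq cl have "g (finprod G (\<lambda>x. s x [^]\<^bsub>G\<^esub> d (Inr x)) BC) = \<one>\<^bsub>C\<^esub>"
        by (metis C.l_one f.hom_closed g.hom_closed g.hom_mult g.hom_one)
      then have "finprod C (\<lambda>x. g (s x) [^]\<^bsub>C\<^esub> d (Inr x)) BC = \<one>\<^bsub>C\<^esub>"
        using BC' s by (subst (asm) hom_finprod_int_pow[OF G(2,3) g(1)]) auto
      also have "finprod C (\<lambda>x. g (s x) [^]\<^bsub>C\<^esub> d (Inr x)) BC = finprod C (\<lambda>x. x [^]\<^bsub>C\<^esub> d (Inr x)) BC"
        using BC' s by (intro C.finprod_cong') auto
      finally have dC: "\<forall>x\<in>BC. d (Inr x) = 0"
        using integrally_independentD[OF BC(1), of "\<lambda>x. d (Inr x)"] by blast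
      then have "finprod G (\<lambda>x. s x [^]\<^bsub>G\<^esub> d (Inr x)) BC = \<one>\<^bsub>G\<^esub>"
        by (intro G.finprod_one_eqI) auto
      with eq cl have "f (finprod A (\<lambda>x. x [^]\<^bsub>A\<^esub> d (Inl x)) BA) = f \<one>\<^bsub>A\<^esub>"
        by simp
      then have "finprod A (\<lambda>x. x [^]\<^bsub>A\<^esub> d (Inl x)) BA = \<one>\<^bsub>A\<^esub>"
        using inj_onD[OF f(2) _ cl(1) A.one_closed] by simp
      then have dA: "\<forall>x\<in>BA. d (Inl x) = 0"
        using integrally_independentD[OF BA(1), of "\<lambda>x. d (Inl x)"] by blast
      show "\<forall>i\<in>BA <+> BC. d i = 0"
        using dA dC by auto
    qed (use BA' BC' bcl in auto)
  qed
qed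

lemma trivial_group_imp_comm_group: "trivial_group G \<Longrightarrow> comm_group G"
  by (simp add: group.cyclic_imp_abelian_group trivial_imp_cyclic_group trivial_group_def)

lemma abelian_group_rank_trivial:
  fixes G (structure)
  assumes "trivial_group G"
  shows "abelian_group_rank G = enat 0"
proof -
  interpret comm_group G
    by (rule trivial_group_imp_comm_group[OF assms])
  have "B = {}" if "integrally_independent G B" for B
  proof (rule ccontr)
    assume "B \<noteq> {}"
    have "finprod G (\<lambda>b. b [^] (1::int)) B \<in> carrier G"
      using that by (intro finprod_closed) (auto simp: integrally_independent_def)
    then have "finprod G (\<lambda>b. b [^] (1::int)) B = \<one>"
      using assms by (auto simp: trivial_group_def)
    then show False
      using that \<open>B \<noteq> {}\<close> integrally_independentD[of G B "\<lambda>_. 1"] by auto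
  qed
  moreover have "integrally_independent G {}"
    by (simp add: integrally_independent_def)
  ultimately show ?thesis
    unfolding abelian_group_rank_eq_enat_iff by fastforce
qed

lemma abelian_group_rank_iso:
  assumes "comm_group G" "comm_group H" "G \<cong> H" "abelian_group_rank G = enat r"
  shows "abelian_group_rank H = enat r"
proof -
  obtain h where h: "h \<in> iso G H"
    using assms(3) by (auto simp: is_iso_def)
  interpret H: comm_group H by fact
  \<comment> \<open>An isomorphism is an extension with trivial quotient.\<close>
  let ?T = "singleton_group \<one>\<^bsub>H\<^esub>"
  have T: "trivial_group ?T" by simp
  have "abelian_group_rank H = enat (r + 0)"
  proof (rule abelian_group_rank_extension[OF assms(1,2) _ _ _ _ _ _ assms(4) abelian_group_rank_trivial[OF T]])
    show "comm_group ?T"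
      by (rule trivial_group_imp_comm_group[OF T])
    show "h \<in> hom G H" "inj_on h (carrier G)"
      using h by (auto simp: iso_def bij_betw_def)
    show "(\<lambda>_. \<one>\<^bsub>H\<^esub>) \<in> hom H ?T" "(\<lambda>_. \<one>\<^bsub>H\<^esub>) ` carrier H = carrier ?T"
      by (auto simp: hom_def singleton_group_def)
    show "kernel H ?T (\<lambda>_. \<one>\<^bsub>H\<^esub>) = h ` carrier G"
      using h by (auto simp: iso_def bij_betw_def kernel_def singleton_group_def)
  qed
  then show ?thesis by simp
qed

lemma abelian_group_rank_integer_group: "abelian_group_rank integer_group = enat 1"
proof -
  interpret comm_group integer_group by (rule abelian_integer_group)
  show ?thesis
  proof (rule abelian_group_rank_eqI)
    show "independent_family integer_group (\<lambda>_::unit. 1) UNIV"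
      by (auto simp: independent_family_def UNIV_unit)
    fix B assume B: "integrally_independent integer_group B"
    show "card B \<le> 1"
    proof (rule ccontr)
      assume "\<not> card B \<le> 1"
      then obtain x y where xy: "x \<in> B" "y \<in> B" "x \<noteq> y"
        by (metis One_nat_def card_le_Suc0_iff_eq card.infinite le0 linorder_linear)
      \<comment> \<open>Two integers always satisfy the relation \<open>y * x - x * y = 0\<close>.\<close>
      define c where "c = (\<lambda>_. 0)(x := y, y := - x)"
      have "finprod integer_group (\<lambda>b. b [^]\<^bsub>integer_group\<^esub> c b) B
          = finprod integer_group (\<lambda>b. b [^]\<^bsub>integer_group\<^esub> c b) {x, y}"
        using B xy by (intro finprod_mono_neutral_cong_right) (auto simp: integrally_independent_def c_def)
      also have "\<dots> = 0"
        using xy by (simp add: c_def)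
      finally have "c x = 0 \<and> c y = 0"
        using B xy by (auto simp: integrally_independent_def)
      then show False
        using xy by (simp add: c_def)
    qed
  qed simp
qed

section \<open>Homology of complements of coordinate subspaces\<close>

lemma short_exact_sequence_rank:
  assumes "short_exact_sequence C G A g f" "comm_group A" "comm_group G" "comm_group C"
    and "abelian_group_rank A = enat a" "abelian_group_rank C = enat c"
  shows "abelian_group_rank G = enat (a + c)"
  using short_exact_sequenceD[OF assms(1)] assms(2-)
  by (intro abelian_group_rank_extension[of A G C f g])
     (auto simp: epi_def mon_def)

definition shift_coord :: "'n \<Rightarrow> real \<Rightarrow> real ^ 'n \<Rightarrow> real ^ 'n" where
  "shift_coord j t x = x + (t - x $ j) *\<^sub>R axis j 1"

lemma continuous_on_shift_coord [continuous_intros]: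
  assumes "continuous_on S f" "continuous_on S g"
  shows "continuous_on S (\<lambda>x. shift_coord j (f x) (g x))"
  unfolding shift_coord_def by (intro continuous_intros assms)

lemma shift_coord_nth [simp]: "shift_coord j t x $ i = (if i = j then t else x $ i)"
  by (simp add: shift_coord_def axis_def)

definition slides_along :: "'n \<Rightarrow> (real ^ 'n) set \<Rightarrow> bool" where
  "slides_along j S \<longleftrightarrow> (\<forall>x\<in>S. \<forall>t. shift_coord j t x \<in> S)"

lemma homotopic_shift_coord:
  fixes S :: "(real ^ 'n) set"
  assumes "\<And>x s. x \<in> S \<Longrightarrow> 0 \<le> s \<Longrightarrow> s \<le> 1 \<Longrightarrow> shift_coord j ((1 - s) * t + s * x $ j) x \<in> S"
    and "\<And>x s. x \<in> T \<Longrightarrow> 0 \<le> s \<Longrightarrow> s \<le> 1 \<Longrightarrow> shift_coord j ((1 - s) * t + s * x $ j) x \<in> T"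
  shows "homotopic_with (\<lambda>h. h \<in> T \<rightarrow> T) (top_of_set S) (top_of_set S) (shift_coord j t) id"
  unfolding homotopic_with_def
proof (intro exI conjI ballI allI)
  let ?h = "\<lambda>(s, x). shift_coord j ((1 - s) * t + s * x $ j) x"
  show "continuous_map (prod_topology (top_of_set {0..1}) (top_of_set S)) (top_of_set S) ?h"
    using assms(1)
    by (auto simp: prod_topology_subtopology_eu case_prod_unfold intro!: continuous_intros)
qed (use assms(2) in \<open>auto simp: vec_eq_iff\<close>)

lemma iso_sym_homology: "relative_homology_group p X S \<cong> H \<Longrightarrow> H \<cong> relative_homology_group p X S"
  by (simp add: group.iso_sym)

text \<open>Splitting off the \<open>j\<close>-th coordinate, the pair on the left is the product of \<open>(A, B)\<close> with the pair
\<open>(\<real>, \<real> - {0})\<close>, whose homology is that of \<open>(A, B)\<close> shifted by one degree.  The proof avoids a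
product formula.  Let \<open>N\<close> be the set \<open>B\<close> with the part of \<open>A\<close> above the hyperplane added, so that
\<open>A\<close> can be pushed upwards into \<open>N\<close> and \<open>H(A, N) = 0\<close>.  The long exact sequence of the triple
\<open>N \<subseteq> W \<subseteq> A\<close> then identifies \<open>H\<^sub>p(A, W)\<close> with \<open>H\<^sub>p\<^sub>-\<^sub>1(W, N)\<close>; excising everything that is not below
the hyperplane leaves the lower part of \<open>(A, B)\<close>, which is homotopy equivalent to \<open>(A, B)\<close>.\<close>

lemma relative_homology_group_suspension:
  fixes A B :: "(real ^ 'n) set"
  assumes "open A" "open B" "B \<subseteq> A" "slides_along j A" "slides_along j B"
  shows "relative_homology_group p (top_of_set A) (B \<union> {x \<in> A. x $ j \<noteq> 0})
       \<cong> relative_homology_group (p - 1) (top_of_set A) B"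
proof -
  define W where "W = B \<union> {x \<in> A. x $ j \<noteq> 0}"
  define N where "N = B \<union> {x \<in> A. x $ j > 0}"
  define V where "V = {x \<in> A. x $ j < 0}"
  have NW: "N \<subseteq> W" and WA: "W \<subseteq> A" and VW: "V \<subseteq> W"
    using assms(3) by (auto simp: N_def W_def V_def)
  have opN: "open N" and opV: "open V"
    unfolding N_def V_def Collect_conj_eq
    by (intro open_Un open_Int assms(1,2) open_Collect_less continuous_intros; simp add: assms)+
  have A: "shift_coord j t x \<in> A" if "x \<in> A" for t x
    using assms(4) that by (auto simp: slides_along_def)
  have B: "shift_coord j t x \<in> B" if "x \<in> B" for t x
    using assms(5) that by (auto simp: slides_along_def)
  \<comment> \<open>Pushing the \<open>j\<close>-th coordinate linearly to \<open>1\<close> deforms \<open>A\<close> into \<open>N\<close> and keeps \<open>N\<close> in itself.\<close>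
  have triv: "trivial_group (relative_homology_group q (top_of_set A) N)" for q
  proof (rule trivial_relative_homology_group_alt)
    show "continuous_map (top_of_set A) (subtopology (top_of_set A) N) (shift_coord j 1)"
      using A WA NW
      by (auto simp: subtopology_subtopology N_def intro!: continuous_intros)
    have "shift_coord j ((1 - s) * 1 + s * x $ j) x \<in> N" if "x \<in> N" "0 \<le> s" "s \<le> 1" for x s
    proof (cases "x \<in> B")
      case False
      then have "0 < x $ j" "x \<in> A"
        using that by (auto simp: N_def)
      then have "0 < (1 - s) * 1 + s * x $ j"
        using that by (cases "s = 0") (auto intro: add_nonneg_pos)
      then show ?thesis
        using A \<open>x \<in> A\<close> by (auto simp: N_def)
    qed (use B in \<open>auto simp: N_def\<close>)
    then have "homotopic_with (\<lambda>h. h \<in> N \<rightarrow> N) (top_of_set A) (top_of_set A) (shift_coord j 1) id"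
      by (intro homotopic_shift_coord) (auto intro: A)
    then show "homotopic_with (\<lambda>k. k ` N \<subseteq> N) (top_of_set A) (top_of_set A) (shift_coord j 1) id"
      by (rule homotopic_with_mono) auto
  qed
  have "hom_relboundary p (top_of_set A) W N
     \<in> iso (relative_homology_group p (top_of_set A) W)
           (relative_homology_group (p - 1) (subtopology (top_of_set A) W) N)"
  proof (rule very_short_exact_sequence[OF _ triv[of p] triv[of "p - 1"]])
    show "exact_seq ([relative_homology_group (p - 1) (top_of_set A) N,
        relative_homology_group (p - 1) (subtopology (top_of_set A) W) N,
        relative_homology_group p (top_of_set A) W, relative_homology_group p (top_of_set A) N],
       [hom_induced (p - 1) (subtopology (top_of_set A) W) N (top_of_set A) N id,
        hom_relboundary p (top_of_set A) W N, hom_induced p (top_of_set A) N (top_of_set A) W id])"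
      using homology_exactness_triple_1[OF NW] homology_exactness_triple_2[OF NW]
      by (metis exact_seq_cons_iff)
  qed
  then have 1: "relative_homology_group p (top_of_set A) W
      \<cong> relative_homology_group (p - 1) (top_of_set W) N"
    using WA by (auto simp: is_iso_def subtopology_subtopology inf_absorb2)
  \<comment> \<open>Excision of \<open>W - V\<close>, which is closed in \<open>W\<close> and contained in the open set \<open>N\<close>.\<close>
  have op: "openin (top_of_set W) V" "openin (top_of_set W) N"
    using opN opV VW NW by (auto simp: open_openin_trans openin_open_eq intro: open_subset)
  have "top_of_set W closure_of (W - V) \<subseteq> top_of_set W interior_of N"
  proof -
    have "closedin (top_of_set W) (W - V)"
      using closedin_diff[OF closedin_topspace op(1)] by simp
    then have "top_of_set W closure_of (W - V) = W - V"
      by (simp add: closure_of_closedin)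
    moreover have "W - V \<subseteq> N"
      by (auto simp: W_def V_def N_def)
    moreover have "top_of_set W interior_of N = N"
      using op(2) by (simp add: interior_of_openin)
    ultimately show ?thesis by simp
  qed
  from homology_excision_axiom[OF this NW, of "p - 1"]
  have "relative_homology_group (p - 1) (subtopology (top_of_set W) (W - (W - V))) (N - (W - V))
     \<cong> relative_homology_group (p - 1) (subtopology (top_of_set W) W) N"
    by (auto simp: is_iso_def)
  moreover have "W - (W - V) = V" "N - (W - V) = B \<inter> V"
    using VW assms(3) by (auto simp: W_def N_def V_def)
  ultimately have 2: "relative_homology_group (p - 1) (top_of_set V) (B \<inter> V)
     \<cong> relative_homology_group (p - 1) (top_of_set W) N"
    using VW by (simp add: subtopology_subtopology inf_absorb2)
  have 3: "relative_homology_group (p - 1) (top_of_set V) (B \<inter> V)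
     \<cong> relative_homology_group (p - 1) (top_of_set A) B"
  proof (rule homotopy_equivalent_space_imp_isomorphic_relative_homology_groups)
    show "continuous_map (top_of_set V) (top_of_set A) id" "id \<in> B \<inter> V \<rightarrow> B"
      by (auto simp: V_def)
    show "continuous_map (top_of_set A) (top_of_set V) (shift_coord j (-1))"
      "shift_coord j (-1) \<in> B \<rightarrow> B \<inter> V"
      using A B assms(3) by (auto simp: V_def intro!: continuous_intros)
    have neg: "(s - 1) + s * x $ j < 0" if "0 \<le> s" "s \<le> 1" "x $ j < 0" for s and x :: "real ^ 'n"
      using that by (cases "s = 0") (auto simp: mult_pos_neg add_nonpos_neg)
    show "homotopic_with (\<lambda>h. h \<in> B \<inter> V \<rightarrow> B \<inter> V) (top_of_set V) (top_of_set V) (shift_coord j (- 1) \<circ> id) id"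
      unfolding comp_id
      by (rule homotopic_shift_coord) (use A B neg in \<open>auto simp: V_def\<close>)
    show "homotopic_with (\<lambda>k. k \<in> B \<rightarrow> B) (top_of_set A) (top_of_set A) (id \<circ> shift_coord j (- 1)) id"
      unfolding id_comp
      by (rule homotopic_shift_coord) (use A B in auto)
  qed
  show ?thesis
    using 1 2 3 unfolding W_def by (meson iso_sym_homology iso_trans)
qed

text \<open>For \<open>I = UNIV\<close> this is the complement of the arrangement of all coordinate subspaces of codimension
\<open>k\<close>.  Counting zeros only in \<open>I\<close> makes it possible to add one coordinate at a time without changing
the ambient space.\<close>

definition few_zeros :: "'n set \<Rightarrow> nat \<Rightarrow> (real ^ 'n) set" where
  "few_zeros I k = {x. card {i \<in> I. x $ i = 0} < k}"

lemma few_zeros_mono: "k \<le> l \<Longrightarrow> few_zeros I k \<subseteq> few_zeros I l"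
  by (auto simp: few_zeros_def)

text \<open>In this shape the suspension isomorphism applies: in the first part the \<open>j\<close>-th coordinate is free, in
the second it must not vanish, since the remaining coordinates already have \<open>k\<close> zeros in the worst case.\<close>

lemma few_zeros_insert:
  fixes I :: "'n::finite set"
  assumes "j \<notin> I"
  shows "few_zeros (insert j I) (Suc k) = few_zeros I k \<union> {x \<in> few_zeros I (Suc k). x $ j \<noteq> 0}"
proof -
  have "{i \<in> insert j I. x $ i = 0} = (if x $ j = 0 then insert j {i \<in> I. x $ i = 0} else {i \<in> I. x $ i = 0})"
    for x :: "real ^ 'n"
    by auto
  then show ?thesis
    using assms by (auto simp: few_zeros_def)
qed

lemma open_few_zeros: "open (few_zeros I k :: (real ^ 'n) set)"
proof -
  have eq: "few_zeros I k = (\<Union>Z\<in>{Z. card Z < k}. \<Inter>i\<in>I - Z. {x :: real ^ 'n. x $ i \<noteq> 0})"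
  proof (intro equalityI subsetI)
    fix x :: "real ^ 'n" assume "x \<in> few_zeros I k"
    then show "x \<in> (\<Union>Z\<in>{Z. card Z < k}. \<Inter>i\<in>I - Z. {x. x $ i \<noteq> 0})"
      by (auto simp: few_zeros_def intro!: exI[of _ "{i \<in> I. x $ i = 0}"])
  next
    fix x :: "real ^ 'n" assume "x \<in> (\<Union>Z\<in>{Z. card Z < k}. \<Inter>i\<in>I - Z. {x. x $ i \<noteq> 0})"
    then obtain Z where Z: "card Z < k" "\<And>i. i \<in> I - Z \<Longrightarrow> x $ i \<noteq> 0"
      by auto
    then have "card {i \<in> I. x $ i = 0} \<le> card Z"
      by (intro card_mono) auto
    then show "x \<in> few_zeros I k"
      using Z by (simp add: few_zeros_def)
  qed
  show ?thesis
    unfolding eq by (intro open_UN ballI open_INT open_Collect_neq continuous_intros) auto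
qed

lemma slides_along_few_zeros:
  assumes "j \<notin> I"
  shows "slides_along j (few_zeros I k)"
proof -
  have "{i \<in> I. shift_coord j t x $ i = 0} = {i \<in> I. x $ i = 0}" for t x
    using assms by auto
  then show ?thesis
    by (simp add: slides_along_def few_zeros_def)
qed

text \<open>The number of independent \<open>(k-1)\<close>-dimensional cycles (reduced ones for \<open>k = 1\<close>) in the
\<open>(k-1)\<close>-skeleton of the \<open>m\<close>-dimensional cube.  In one dimension more, the skeleton consists of two
copies of the old one, at the two ends of the new direction, joined by the product of an interval with the
old skeleton of one dimension less; this is the recurrence.\<close>

fun skeleton_rank :: "nat \<Rightarrow> nat \<Rightarrow> nat" where
  "skeleton_rank m 0 = 1"
| "skeleton_rank 0 (Suc k) = 0"
| "skeleton_rank (Suc m) (Suc k) = 2 * skeleton_rank m (Suc k) + skeleton_rank m k"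

lemma exact_seq_trivial_mid:
  assumes "exact_seq ([C, B, A], [g, f])" "trivial_group A" "trivial_group C"
  shows "trivial_group B"
proof -
  have f: "group_hom A B f" and g: "group_hom B C g" and ex: "kernel B C g = f ` carrier A"
    using assms(1) by (auto simp: group_hom_def group_hom_axioms_def)
  have "kernel B C g = carrier B"
    by (rule group_hom.kernel_to_trivial_group[OF g assms(3)])
  moreover have "f ` carrier A = {\<one>\<^bsub>B\<^esub>}"
    by (rule group_hom.image_from_trivial_group[OF f assms(2)])
  ultimately show ?thesis
    using ex g by (auto simp: trivial_group_def group_hom_def)
qed

lemma short_exact_sequenceI:
  assumes "exact_seq ([T, A, B], [e, f])" "exact_seq ([A, B, C], [f, g])" "exact_seq ([B, C, T'], [g, e'])"
    and "trivial_group T" "trivial_group T'"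
  shows "short_exact_sequence A B C f g"
  unfolding short_exact_sequence_def
  by (rule exI[of _ T], rule exI[of _ T'], rule exI[of _ e], rule exI[of _ e'])
     (use assms in \<open>simp\<close>)

lemma contractible_space_euclidean_vec: "contractible_space (euclidean :: (real ^ 'n) topology)"
  using contractible_space_top_of_set[of "UNIV :: (real ^ 'n) set"] convex_imp_contractible[OF convex_UNIV]
  by (simp del: contractible_space_top_of_set)

lemma homology_euclidean:
  "p \<noteq> 0 \<Longrightarrow> trivial_group (homology_group p (euclidean :: (real ^ 'n) topology))"
  "abelian_group_rank (homology_group 0 (euclidean :: (real ^ 'n) topology)) = enat 1"
proof -
  note c = contractible_space_euclidean_vec
  show "trivial_group (homology_group p (euclidean :: (real ^ 'n) topology))" if "p \<noteq> 0"
    using trivial_reduced_homology_group_contractible_space[OF c, of p] that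
    by (simp add: un_reduced_homology_group)
  have "homology_group 0 (euclidean :: (real ^ 'n) topology) \<cong> integer_group"
    using c by (intro isomorphic_integer_zeroth_homology_group contractible_imp_path_connected_space) auto
  then show "abelian_group_rank (homology_group 0 (euclidean :: (real ^ 'n) topology)) = enat 1"
    using abelian_group_rank_iso[OF abelian_integer_group _ _ abelian_group_rank_integer_group] iso_sym_homology
    by (metis abelian_relative_homology_group)
qed

lemma few_zeros_0 [simp]: "few_zeros I 0 = {}"
  by (simp add: few_zeros_def)

text \<open>By induction on \<open>I\<close>.  Write \<open>A\<close>, \<open>B\<close>, \<open>W\<close> for the sets of points with at most \<open>l\<close> zeros in \<open>I\<close>, fewer
than \<open>l\<close> zeros in \<open>I\<close>, and at most \<open>l\<close> zeros in \<open>I \<union> {j}\<close>.  Relative to the whole space, \<open>A\<close> and \<open>B\<close>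
have homology in the single degrees \<open>l + 1\<close> and \<open>l\<close>.  Hence the long exact sequence of the triple
\<open>B \<subseteq> A\<close> is a short exact sequence that puts the homology of \<open>(A, B)\<close> into degree \<open>l\<close>; by suspension
that of \<open>(A, W)\<close> is in degree \<open>l + 1\<close>; and the long exact sequence of the triple \<open>W \<subseteq> A\<close> again
reduces to a short exact sequence in degree \<open>l + 1\<close>.  Adding the ranks gives the recurrence.  Using
homology relative to the ambient space instead of reduced homology lets the induction start with the
empty set, at \<open>k = 0\<close>.\<close>

lemma relative_homology_few_zeros:
  fixes I :: "'n::finite set"
  shows "(\<forall>p. p \<noteq> int k \<longrightarrow> trivial_group (relative_homology_group p euclidean (few_zeros I k :: (real ^ 'n) set))) \<and>
     abelian_group_rank (relative_homology_group (int k) euclidean (few_zeros I k :: (real ^ 'n) set))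
       = enat (skeleton_rank (card I) k)"
  using finite[of I]
proof (induction I arbitrary: k rule: finite_induct)
  case empty
  show ?case
  proof (cases k)
    case 0
    then show ?thesis by (simp add: homology_euclidean)
  next
    case (Suc l)
    then have "few_zeros {} k = (UNIV :: (real ^ 'n) set)"
      by (simp add: few_zeros_def)
    then have "trivial_group (relative_homology_group p euclidean (few_zeros {} k :: (real ^ 'n) set))" for p
      using trivial_relative_homology_group_topspace[of p "euclidean :: (real ^ 'n) topology"] by simp
    then show ?thesis
      using Suc abelian_group_rank_trivial by auto
  qed
next
  case (insert j I)
  show ?case
  proof (cases k)
    case 0
    then show ?thesis by (simp add: homology_euclidean)
  next
    case (Suc l)
    define A B W :: "(real ^ 'n) set"
      where "A = few_zeros I (Suc l)" and "B = few_zeros I l" and "W = few_zeros (insert j I) (Suc l)"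
    have BA: "B \<subseteq> A"
      using few_zeros_mono[of l "Suc l" I] by (simp add: A_def B_def)
    have W: "W = B \<union> {x \<in> A. x $ j \<noteq> 0}"
      using insert by (simp add: W_def A_def B_def few_zeros_insert)
    then have WA: "W \<subseteq> A"
      using BA by auto
    have HA: "trivial_group (relative_homology_group p euclidean A)" if "p \<noteq> int l + 1" for p
      using insert.IH[of "Suc l"] that by (simp add: A_def)
    have HB: "trivial_group (relative_homology_group p euclidean B)" if "p \<noteq> int l" for p
      using insert.IH[of l] that by (simp add: B_def)
    have rA: "abelian_group_rank (relative_homology_group (int l + 1) euclidean A)
        = enat (skeleton_rank (card I) (Suc l))"
      using insert.IH[of "Suc l"] by (simp add: A_def add.commute)
    have rB: "abelian_group_rank (relative_homology_group (int l) euclidean B) = enat (skeleton_rank (card I) l)"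
      using insert.IH[of l] by (simp add: B_def)
    have susp: "relative_homology_group p (top_of_set A) W \<cong> relative_homology_group (p - 1) (top_of_set A) B" for p
      unfolding W using insert.hyps
      by (intro relative_homology_group_suspension BA)
         (auto simp: A_def B_def open_few_zeros slides_along_few_zeros)
    have HAB: "trivial_group (relative_homology_group (p - 1) (top_of_set A) B)" if "p \<noteq> int l + 1" for p
      by (rule exact_seq_trivial_mid[OF homology_exactness_triple_2[OF BA, of p euclidean]])
         (use that HA HB in auto)
    have HAW: "trivial_group (relative_homology_group p (top_of_set A) W)" if "p \<noteq> int l + 1" for p
      using isomorphic_group_triviality[OF susp] HAB[OF that] by simp
    have "short_exact_sequence (relative_homology_group (int l) euclidean B)
        (relative_homology_group (int l) (top_of_set A) B) (relative_homology_group (int l + 1) euclidean A)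
        (hom_induced (int l) (top_of_set A) B euclidean B id) (hom_relboundary (int l + 1) euclidean A B)"
      using short_exact_sequenceI[OF homology_exactness_triple_3[OF BA, of "int l" euclidean]
        homology_exactness_triple_2[OF BA, of "int l + 1" euclidean, unfolded add_diff_cancel_right']
        homology_exactness_triple_1[OF BA, of "int l + 1" euclidean, unfolded add_diff_cancel_right']] HA HB by simp
    then have "abelian_group_rank (relative_homology_group (int l) (top_of_set A) B)
        = enat (skeleton_rank (card I) (Suc l) + skeleton_rank (card I) l)"
      by (rule short_exact_sequence_rank) (use rA rB in auto)
    then have rAW: "abelian_group_rank (relative_homology_group (int l + 1) (top_of_set A) W)
        = enat (skeleton_rank (card I) (Suc l) + skeleton_rank (card I) l)"
      using abelian_group_rank_iso[OF _ _ iso_sym_homology[OF susp[of "int l + 1"]]] by simp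
    have "short_exact_sequence (relative_homology_group (int l + 1) euclidean A)
        (relative_homology_group (int l + 1) euclidean W) (relative_homology_group (int l + 1) (top_of_set A) W)
        (hom_induced (int l + 1) euclidean W euclidean A id)
        (hom_induced (int l + 1) (top_of_set A) W euclidean W id)"
      using short_exact_sequenceI[OF homology_exactness_triple_1[OF WA, of "int l + 1" euclidean]
        homology_exactness_triple_3[OF WA, of "int l + 1" euclidean]
        homology_exactness_triple_2[OF WA, of "int l + 1 + 1" euclidean, unfolded add_diff_cancel_right']] HA HAW by simp
    then have "abelian_group_rank (relative_homology_group (int l + 1) euclidean W)
        = enat (skeleton_rank (card I) (Suc l) + skeleton_rank (card I) l + skeleton_rank (card I) (Suc l))"
      by (rule short_exact_sequence_rank) (use rA rAW in auto)
    moreover have "trivial_group (relative_homology_group p euclidean W)" if "p \<noteq> int l + 1" for p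
      by (rule exact_seq_trivial_mid[OF homology_exactness_triple_3[OF WA, of p euclidean]])
         (use that HA HAW in auto)
    ultimately show ?thesis
      using insert.hyps Suc by (simp add: W_def algebra_simps)
  qed
qed

section \<open>The faces of the half cube\<close>

definition odd_sign_vectors :: "(real ^ 'n) set" where
  "odd_sign_vectors = {x. (\<forall>i. x $ i \<in> {1, -1}) \<and> odd (card {i. x $ i < 0})}"

lemma even_sign_vectors_nth: "v \<in> even_sign_vectors \<Longrightarrow> v $ i = 1 \<or> v $ i = -1"
  by (auto simp: even_sign_vectors_def)

lemma even_sign_vectors_abs: "v \<in> even_sign_vectors \<Longrightarrow> \<bar>v $ i\<bar> = 1"
  using even_sign_vectors_nth[of v i] by auto

lemma odd_sign_vectors_nth: "w \<in> odd_sign_vectors \<Longrightarrow> w $ i = 1 \<or> w $ i = -1"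
  by (auto simp: odd_sign_vectors_def)

lemma finite_sign_vectors: "finite {x :: real ^ 'n. \<forall>i. x $ i \<in> {1, -1}}"
proof (rule inj_on_finite)
  show "inj_on (\<lambda>x :: real ^ 'n. {i. x $ i < 0}) {x. \<forall>i. x $ i \<in> {1, -1}}"
  proof (rule inj_onI, unfold mem_Collect_eq)
    fix x y :: "real ^ 'n"
    assume x: "\<forall>i. x $ i \<in> {1, -1}" and y: "\<forall>i. y $ i \<in> {1, -1}" and eq: "{i. x $ i < 0} = {i. y $ i < 0}"
    have "x $ i = y $ i" for i
      using x[rule_format, of i] y[rule_format, of i] eq by (auto simp: set_eq_iff dest: spec[of _ i])
    then show "x = y" by (simp add: vec_eq_iff)
  qed
qed auto

lemma finite_even_sign_vectors: "finite (even_sign_vectors :: (real ^ 'n) set)"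
  by (rule finite_subset[OF _ finite_sign_vectors]) (auto simp: even_sign_vectors_def)

lemma finite_odd_sign_vectors: "finite (odd_sign_vectors :: (real ^ 'n) set)"
  by (rule finite_subset[OF _ finite_sign_vectors]) (auto simp: odd_sign_vectors_def)

lemma sign_vector_flip:
  fixes x :: "real ^ 'n"
  assumes "\<forall>i. x $ i \<in> {1, -1}"
  shows "(x - (2 * x $ j) *\<^sub>R axis j 1) $ i = (if i = j then - x $ i else x $ i)"
    and "even (card {i. (x - (2 * x $ j) *\<^sub>R axis j 1) $ i < 0}) \<longleftrightarrow> odd (card {i. x $ i < 0})"
proof -
  show nth: "(x - (2 * x $ j) *\<^sub>R axis j 1) $ i = (if i = j then - x $ i else x $ i)" for i
    by (simp add: axis_def)
  define N where "N = {i. i \<noteq> j \<and> x $ i < 0}"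
  have "{i. x $ i < 0} = (if x $ j < 0 then insert j N else N)"
    by (auto simp: N_def)
  moreover have "{i. (x - (2 * x $ j) *\<^sub>R axis j 1) $ i < 0} = (if x $ j < 0 then N else insert j N)"
    using assms[rule_format, of j] unfolding nth by (auto simp: N_def)
  moreover have "card (insert j N) = Suc (card N)"
    by (simp add: N_def)
  ultimately show "even (card {i. (x - (2 * x $ j) *\<^sub>R axis j 1) $ i < 0}) \<longleftrightarrow> odd (card {i. x $ i < 0})"
    by simp
qed

lemma odd_sign_vector_flip:
  "w \<in> odd_sign_vectors \<Longrightarrow> w - (2 * w $ j) *\<^sub>R axis j 1 \<in> even_sign_vectors"
  using sign_vector_flip[of w j]
  by (auto simp: odd_sign_vectors_def even_sign_vectors_def simp del: vector_minus_component vector_scaleR_component)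

lemma even_sign_vector_flip:
  "v \<in> even_sign_vectors \<Longrightarrow> v - (2 * v $ j) *\<^sub>R axis j 1 \<in> odd_sign_vectors"
  using sign_vector_flip[of v j]
  by (auto simp: odd_sign_vectors_def even_sign_vectors_def simp del: vector_minus_component vector_scaleR_component)

lemma inner_vec_real: "(x :: real ^ 'n) \<bullet> y = (\<Sum>i\<in>UNIV. x $ i * y $ i)"
  by (simp add: inner_vec_def)

lemma sign_vector_mult_le_1: "\<lbrakk>w \<in> odd_sign_vectors; \<bar>x $ i\<bar> \<le> 1\<rbrakk> \<Longrightarrow> w $ i * x $ i \<le> 1"
  using odd_sign_vectors_nth[of w i] by auto

lemma inner_odd_even_le:
  fixes v w :: "real ^ 'n"
  assumes v: "v \<in> even_sign_vectors" and w: "w \<in> odd_sign_vectors"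
  shows "w \<bullet> v \<le> real CARD('n) - 2"
proof -
  have "v \<noteq> w"
    using v w by (auto simp: even_sign_vectors_def odd_sign_vectors_def)
  then obtain i where i: "v $ i \<noteq> w $ i"
    by (auto simp: vec_eq_iff)
  have "w \<bullet> v = w $ i * v $ i + (\<Sum>j\<in>UNIV - {i}. w $ j * v $ j)"
    by (simp add: inner_vec_real sum.remove[of UNIV i])
  also have "w $ i * v $ i = -1"
    using i even_sign_vectors_nth[OF v, of i] odd_sign_vectors_nth[OF w, of i] by auto
  also have "(\<Sum>j\<in>UNIV - {i}. w $ j * v $ j) \<le> (\<Sum>j\<in>UNIV - {i}. 1)"
    by (intro sum_mono sign_vector_mult_le_1[OF w]) (simp add: even_sign_vectors_abs[OF v])
  finally show ?thesis
    by (simp add: of_nat_diff)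
qed

text \<open>The part of the cube on the hyperplane \<open>w \<bullet> x = n - 2\<close> is the simplex spanned by the \<open>n\<close> neighbours of
the corner \<open>w\<close>, all of which are even.  The barycentric coordinate of \<open>x\<close> that belongs to the
neighbour in direction \<open>i\<close> is \<open>(1 - w\<^sub>i x\<^sub>i) / 2\<close>.\<close>

lemma corner_facet_subset_half_cube:
  fixes x w :: "real ^ 'n"
  assumes x: "\<forall>i. \<bar>x $ i\<bar> \<le> 1" and w: "w \<in> odd_sign_vectors" and eq: "w \<bullet> x = real CARD('n) - 2"
  shows "x \<in> half_cube"
proof -
  define l where "l i = (1 - w $ i * x $ i) / 2" for i
  have ww: "w $ i * (w $ i * t) = t" for i t
    using odd_sign_vectors_nth[OF w, of i] by auto
  have "(\<Sum>i\<in>UNIV. l i *\<^sub>R (w - (2 * w $ i) *\<^sub>R axis i 1)) \<in> convex hull even_sign_vectors"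
  proof (rule convex_sum)
    have "(\<Sum>i\<in>UNIV. l i) = (real CARD('n) - w \<bullet> x) / 2"
      by (simp add: l_def inner_vec_real sum_subtractf flip: sum_divide_distrib)
    then show "(\<Sum>i\<in>UNIV. l i) = 1"
      using eq by simp
    show "0 \<le> l i" for i
      using sign_vector_mult_le_1[OF w, of x i] x by (simp add: l_def)
    show "w - (2 * w $ i) *\<^sub>R axis i 1 \<in> convex hull even_sign_vectors" for i
      by (intro hull_inc odd_sign_vector_flip w)
  qed auto
  also have "(\<Sum>i\<in>UNIV. l i *\<^sub>R (w - (2 * w $ i) *\<^sub>R axis i 1)) = x"
  proof -
    have "(\<Sum>i\<in>UNIV. l i *\<^sub>R (w - (2 * w $ i) *\<^sub>R axis i 1)) $ j = x $ j" for j
    proof -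
      have "(\<Sum>i\<in>UNIV. l i *\<^sub>R (w - (2 * w $ i) *\<^sub>R axis i 1)) $ j
          = (\<Sum>i\<in>UNIV. l i * w $ j - (if i = j then 2 * l j * w $ j else 0))"
        unfolding sum_component by (intro sum.cong) (auto simp: axis_def algebra_simps)
      also have "\<dots> = (\<Sum>i\<in>UNIV. l i) * w $ j - 2 * l j * w $ j"
        by (simp add: sum_subtractf sum_distrib_right)
      also have "(\<Sum>i\<in>UNIV. l i) = 1"
        using eq by (simp add: l_def inner_vec_real sum_subtractf flip: sum_divide_distrib)
      also have "1 * w $ j - 2 * l j * w $ j = w $ j * (w $ j * x $ j)"
        by (simp add: l_def field_simps)
      also have "\<dots> = x $ j"
        by (rule ww)
      finally show ?thesis .
    qed
    then show ?thesis by (simp add: vec_eq_iff)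
  qed
  finally show ?thesis by (simp add: half_cube_def)
qed

lemma exists_slack:
  fixes f :: "'a \<Rightarrow> real"
  assumes "finite A" "\<And>a. a \<in> A \<Longrightarrow> f a < c"
  obtains e where "e > 0" "\<And>a. a \<in> A \<Longrightarrow> f a + e \<le> c"
proof (cases "A = {}")
  case False
  define e where "e = Min ((\<lambda>a. c - f a) ` A)"
  have "e > 0"
    using assms False by (simp add: e_def)
  moreover have "f a + e \<le> c" if "a \<in> A" for a
  proof -
    have "e \<le> c - f a"
      using assms that by (simp add: e_def)
    then show ?thesis by simp
  qed
  ultimately show ?thesis by (rule that)
qed (auto intro: that[of 1])

text \<open>The half cube is the cube with its odd corners cut off.  For the harder inclusion, consider an extreme
point of the polytope on the right.  If it lies on no cutting hyperplane, any coordinate other than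
\<open>\<plusminus>1\<close> could be moved a little in both directions; so the point is a vertex of the cube, and an even one
because the odd ones are cut off.\<close>

lemma half_cube_eq:
  "half_cube = {x :: real ^ 'n. (\<forall>i. \<bar>x $ i\<bar> \<le> 1) \<and> (\<forall>w\<in>odd_sign_vectors. w \<bullet> x \<le> real CARD('n) - 2)}"
    (is "_ = ?P")
proof
  have Peq: "?P = (\<Inter>i. {x. axis i 1 \<bullet> x \<le> 1} \<inter> {x. - axis i 1 \<bullet> x \<le> 1})
      \<inter> (\<Inter>w\<in>odd_sign_vectors. {x. w \<bullet> x \<le> real CARD('n) - 2})"
    by (auto simp: inner_axis' abs_le_iff minus_le_iff)
  have conv: "convex ?P"
    unfolding Peq by (intro convex_Int convex_INT convex_halfspace_le)
  show "half_cube \<subseteq> ?P"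
    unfolding half_cube_def
  proof (rule hull_minimal[of _ ?P convex, OF _ conv])
    show "even_sign_vectors \<subseteq> ?P"
      by (auto simp: inner_odd_even_le even_sign_vectors_abs)
  qed
  have "closed ?P"
    unfolding Peq by (intro closed_Int closed_INT ballI closed_halfspace_le)
  moreover have "?P \<subseteq> cbox (- 1) 1"
  proof
    fix x assume "x \<in> ?P"
    then have "- 1 \<le> x $ i \<and> x $ i \<le> 1" for i
      using abs_le_iff[of "x $ i" 1] by force
    then show "x \<in> cbox (- 1) 1"
      by (simp add: mem_box_cart)
  qed
  ultimately have "compact ?P"
    using bounded_subset[OF bounded_cbox] compact_eq_bounded_closed by blast
  have "x \<in> half_cube" if x: "x extreme_point_of ?P" for x
  proof (rule ccontr)
    assume nx: "x \<notin> half_cube"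
    have xP: "\<forall>i. \<bar>x $ i\<bar> \<le> 1" "\<And>w. w \<in> odd_sign_vectors \<Longrightarrow> w \<bullet> x \<le> real CARD('n) - 2"
      using x by (auto simp: extreme_point_of_def)
    have lt: "w \<bullet> x < real CARD('n) - 2" if "w \<in> odd_sign_vectors" for w
      using corner_facet_subset_half_cube[OF xP(1) that] xP(2)[OF that] nx by fastforce
    obtain e where e: "e > 0" "\<And>w. w \<in> odd_sign_vectors \<Longrightarrow> w \<bullet> x + e \<le> real CARD('n) - 2"
      using exists_slack[OF finite_odd_sign_vectors, of "\<lambda>w. w \<bullet> x"] lt by metis
    have "\<bar>x $ i\<bar> = 1" for i
    proof (rule ccontr)
      assume "\<bar>x $ i\<bar> \<noteq> 1"
      then have "\<bar>x $ i\<bar> < 1"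
        using xP(1) by (simp add: order_less_le)
      define d where "d = min e (1 - \<bar>x $ i\<bar>)"
      have d: "d > 0" "d \<le> e" "\<bar>x $ i\<bar> + d \<le> 1"
        using e \<open>\<bar>x $ i\<bar> < 1\<close> by (auto simp: d_def)
      have mem: "x + t *\<^sub>R axis i 1 \<in> ?P" if t: "\<bar>t\<bar> \<le> d" for t
      proof (intro CollectI conjI allI ballI)
        fix j
        show "\<bar>(x + t *\<^sub>R axis i 1) $ j\<bar> \<le> 1"
          using xP(1)[rule_format, of j] d t by (auto simp: axis_def)
      next
        fix w :: "real ^ 'n" assume w: "w \<in> odd_sign_vectors"
        have "w \<bullet> (x + t *\<^sub>R axis i 1) = w \<bullet> x + t * w $ i"
          by (simp add: inner_add_right inner_axis)
        also have "t * w $ i \<le> e"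
          using odd_sign_vectors_nth[OF w, of i] t d by auto
        finally show "w \<bullet> (x + t *\<^sub>R axis i 1) \<le> real CARD('n) - 2"
          using e(2)[OF w] by simp
      qed
      let ?a = "x + (- d) *\<^sub>R axis i 1" and ?b = "x + d *\<^sub>R axis i 1"
      have "x = midpoint ?a ?b"
        by (simp add: midpoint_def algebra_simps flip: scaleR_2)
      moreover have "?a \<noteq> ?b"
        using d by (auto simp: vec_eq_iff axis_def)
      ultimately have "x \<in> open_segment ?a ?b"
        using midpoint_in_open_segment by metis
      then show False
        using x mem[of d] mem[of "- d"] d(1) by (auto simp: extreme_point_of_def)
    qed
    then have sgn: "\<forall>i. x $ i \<in> {1, -1}"
      by (auto simp: abs_eq_iff')
    have "x \<notin> even_sign_vectors"
      using nx hull_inc[of x even_sign_vectors convex] by (auto simp: half_cube_def)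
    then have "x \<in> odd_sign_vectors"
      using sgn by (auto simp: even_sign_vectors_def odd_sign_vectors_def)
    moreover have "x \<bullet> x = real CARD('n)"
    proof -
      have "x $ i * x $ i = 1" for i using sgn[rule_format, of i] by auto
      then show ?thesis by (simp add: inner_vec_real)
    qed
    ultimately show False
      using lt by fastforce
  qed
  then have "convex hull {x. x extreme_point_of ?P} \<subseteq> half_cube"
    by (intro hull_minimal) (auto simp: half_cube_def)
  then show "?P \<subseteq> half_cube"
    using Krein_Milman_Minkowski[OF \<open>compact ?P\<close> conv] by simp
qed

lemma convex_half_cube: "convex half_cube"
  by (simp add: half_cube_def)

lemma polytope_half_cube: "polytope (half_cube :: (real ^ 'n) set)"
  unfolding half_cube_def polytope_def using finite_even_sign_vectors by blast

text \<open>The equations \<open>x\<^sub>i = v\<^sub>i\<close> cut out a face because \<open>v\<^sub>i = \<plusminus>1\<close> is an extreme value of the \<open>i\<close>-th coordinate.\<close>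

lemma half_cube_face_of:
  fixes v :: "real ^ 'n"
  assumes v: "v \<in> even_sign_vectors"
  shows "{x \<in> half_cube. \<forall>i. i \<notin> S \<longrightarrow> x $ i = v $ i} face_of half_cube"
  unfolding face_of_def
proof (intro conjI ballI impI)
  have "{x \<in> half_cube. \<forall>i. i \<notin> S \<longrightarrow> x $ i = v $ i} = half_cube \<inter> (\<Inter>i\<in>-S. {x. axis i 1 \<bullet> x = v $ i})"
    by (auto simp: inner_axis')
  then show "convex {x \<in> half_cube. \<forall>i. i \<notin> S \<longrightarrow> x $ i = v $ i}"
    by (simp add: convex_half_cube convex_Int convex_INT convex_hyperplane)
  fix a b x :: "real ^ 'n"
  assume a: "a \<in> half_cube" and b: "b \<in> half_cube"
    and x: "x \<in> {x \<in> half_cube. \<forall>i. i \<notin> S \<longrightarrow> x $ i = v $ i}" and seg: "x \<in> open_segment a b"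
  obtain u where u: "0 < u" "u < 1" "x = (1 - u) *\<^sub>R a + u *\<^sub>R b"
    using seg by (auto simp: in_segment)
  have ab: "a $ i = v $ i \<and> b $ i = v $ i" if i: "i \<notin> S" for i
  proof -
    have le: "\<bar>a $ i\<bar> \<le> 1" "\<bar>b $ i\<bar> \<le> 1"
      using a b by (auto simp: half_cube_eq)
    have "(1 - u) * a $ i + u * b $ i = v $ i"
      using x u i by auto
    then have "v $ i * ((1 - u) * a $ i + u * b $ i) = v $ i * v $ i"
      by simp
    then have eq: "(1 - u) * (1 - v $ i * a $ i) + u * (1 - v $ i * b $ i) = 0"
      using even_sign_vectors_nth[OF v, of i] by (auto simp: algebra_simps)
    have ge: "0 \<le> 1 - v $ i * a $ i" "0 \<le> 1 - v $ i * b $ i"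
      using even_sign_vectors_nth[OF v, of i] le by auto
    then have "(1 - u) * (1 - v $ i * a $ i) = 0" "u * (1 - v $ i * b $ i) = 0"
      using eq u by (auto simp: add_nonneg_eq_0_iff)
    then show ?thesis
      using u even_sign_vectors_nth[OF v, of i] by auto
  qed
  show "a \<in> {x \<in> half_cube. \<forall>i. i \<notin> S \<longrightarrow> x $ i = v $ i}"
    "b \<in> {x \<in> half_cube. \<forall>i. i \<notin> S \<longrightarrow> x $ i = v $ i}"
    using a b ab by auto
qed auto

lemma convex_hull_L_set:
  fixes v :: "real ^ 'n"
  assumes v: "v \<in> even_sign_vectors"
  shows "convex hull L_set v S = {x \<in> half_cube. \<forall>i. i \<notin> S \<longrightarrow> x $ i = v $ i}"
    (is "_ = ?T")
proof
  have face: "?T face_of convex hull even_sign_vectors"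
    using half_cube_face_of[OF v, of S] by (simp add: half_cube_def)
  then have "convex ?T"
    by (rule face_of_imp_convex)
  moreover have "L_set v S \<subseteq> ?T"
    by (auto simp: L_set_def half_cube_def hull_inc)
  ultimately show "convex hull L_set v S \<subseteq> ?T"
    by (rule hull_minimal[rotated])
  obtain V where V: "V \<subseteq> even_sign_vectors" "?T = convex hull V"
    by (rule face_of_convex_hull_subset[OF finite_imp_compact[OF finite_even_sign_vectors] face])
  have "V \<subseteq> L_set v S"
    using hull_subset[of V convex] V by (auto simp: L_set_def)
  then show "?T \<subseteq> convex hull L_set v S"
    using V by (simp add: hull_mono)
qed

lemma open_strict_half_cube:
  "open {x :: real ^ 'n. (\<forall>i\<in>S. \<bar>x $ i\<bar> < 1) \<and> (\<forall>w\<in>odd_sign_vectors. w \<bullet> x < real CARD('n) - 2)}"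
proof -
  have "{x :: real ^ 'n. (\<forall>i\<in>S. \<bar>x $ i\<bar> < 1) \<and> (\<forall>w\<in>odd_sign_vectors. w \<bullet> x < real CARD('n) - 2)}
     = (\<Inter>i\<in>S. {x. \<bar>x $ i\<bar> < 1}) \<inter> (\<Inter>w\<in>odd_sign_vectors. {x. w \<bullet> x < real CARD('n) - 2})"
    by auto
  moreover have "open \<dots>"
    by (intro open_Int open_INT ballI open_Collect_less continuous_intros finite_odd_sign_vectors) auto
  ultimately show ?thesis by simp
qed

text \<open>For \<open>|S| \<ge> 3\<close> the point \<open>c\<close> that agrees with \<open>v\<close> outside \<open>S\<close> and vanishes on \<open>S\<close> satisfies all the
inequalities strictly, because \<open>w \<bullet> c \<le> n - |S| < n - 2\<close>.  A point of the relative interior can be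
moved a little further away from \<open>c\<close> inside the face, so it satisfies them strictly as well.\<close>

lemma rel_interior_L_set:
  fixes v :: "real ^ 'n"
  assumes v: "v \<in> even_sign_vectors" and S: "3 \<le> card S"
  shows "rel_interior (convex hull L_set v S)
    = {x. (\<forall>i\<in>S. \<bar>x $ i\<bar> < 1) \<and> (\<forall>i. i \<notin> S \<longrightarrow> x $ i = v $ i) \<and>
          (\<forall>w\<in>odd_sign_vectors. w \<bullet> x < real CARD('n) - 2)}" (is "_ = ?O")
proof
  let ?T = "convex hull L_set v S"
  let ?U = "{x :: real ^ 'n. (\<forall>i\<in>S. \<bar>x $ i\<bar> < 1) \<and> (\<forall>w\<in>odd_sign_vectors. w \<bullet> x < real CARD('n) - 2)}"
  have T: "?T = {x \<in> half_cube. \<forall>i. i \<notin> S \<longrightarrow> x $ i = v $ i}"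
    by (rule convex_hull_L_set[OF v])
  have OT: "?O \<subseteq> ?T"
  proof
    fix x assume x: "x \<in> ?O"
    have "\<bar>x $ i\<bar> \<le> 1" for i
      using x even_sign_vectors_abs[OF v, of i] by (cases "i \<in> S") (auto intro: order_less_imp_le)
    then show "x \<in> ?T"
      using x by (auto simp: T half_cube_eq order_less_imp_le)
  qed
  have aff: "affine hull ?T \<subseteq> {x. \<forall>i. i \<notin> S \<longrightarrow> x $ i = v $ i}"
  proof (rule hull_minimal)
    have "{x. \<forall>i. i \<notin> S \<longrightarrow> x $ i = v $ i} = (\<Inter>i\<in>-S. {x. axis i 1 \<bullet> x = v $ i})"
      by (auto simp: inner_axis')
    then show "affine {x. \<forall>i. i \<notin> S \<longrightarrow> x $ i = v $ i}"
      by (auto intro!: affine_Inter simp: affine_hyperplane)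
  qed (auto simp: T)
  show "?O \<subseteq> rel_interior ?T"
  proof
    fix x assume x: "x \<in> ?O"
    have "?U \<inter> affine hull ?T \<subseteq> ?T"
      using aff OT by blast
    then show "x \<in> rel_interior ?T"
      unfolding mem_rel_interior using open_strict_half_cube[of S] x OT
      by (intro exI[of _ ?U]) auto
  qed
  define c :: "real ^ 'n" where "c = (\<chi> i. if i \<in> S then 0 else v $ i)"
  have cw: "w \<bullet> c < real CARD('n) - 2" if w: "w \<in> odd_sign_vectors" for w
  proof -
    have "w \<bullet> c = (\<Sum>i\<in>UNIV. if i \<in> S then 0 else w $ i * v $ i)"
      unfolding inner_vec_real by (intro sum.cong) (auto simp: c_def)
    also have "\<dots> \<le> (\<Sum>i\<in>UNIV. if i \<in> S then 0 else 1)"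
      by (intro sum_mono) (simp add: sign_vector_mult_le_1[OF w] even_sign_vectors_abs[OF v])
    also have "\<dots> = real (card (- S))"
      by (simp add: sum.If_cases Compl_eq)
    also have "\<dots> < real CARD('n) - 2"
      using S card_mono[of UNIV S] by (simp add: Compl_eq_Diff_UNIV card_Diff_subset of_nat_diff)
    finally show ?thesis .
  qed
  then have "c \<in> ?O"
    by (auto simp: c_def)
  then have cT: "c \<in> ?T"
    using OT by blast
  show "rel_interior ?T \<subseteq> ?O"
  proof
    fix x assume x: "x \<in> rel_interior ?T"
    then have xT: "x \<in> ?T"
      using rel_interior_subset by blast
    obtain e where e: "e > 1" "(1 - e) *\<^sub>R c + e *\<^sub>R x \<in> ?T"
      using x cT convex_rel_interior_iff[of ?T x] by (metis convex_convex_hull empty_iff)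
    have "\<bar>x $ i\<bar> < 1" if i: "i \<in> S" for i
    proof -
      have "\<bar>((1 - e) *\<^sub>R c + e *\<^sub>R x) $ i\<bar> \<le> 1"
        using e(2) unfolding T half_cube_eq by blast
      then have "e * \<bar>x $ i\<bar> \<le> 1"
        using e(1) i by (simp add: c_def abs_mult)
      moreover have "e * 1 \<le> e * \<bar>x $ i\<bar>" if "1 \<le> \<bar>x $ i\<bar>"
        using that e(1) by (intro mult_left_mono) auto
      ultimately show ?thesis
        using e(1) by linarith
    qed
    moreover have "w \<bullet> x < real CARD('n) - 2" if w: "w \<in> odd_sign_vectors" for w
    proof -
      have "w \<bullet> ((1 - e) *\<^sub>R c + e *\<^sub>R x) \<le> real CARD('n) - 2"
        using e(2) w unfolding T half_cube_eq by blast
      then have "e * (w \<bullet> x) \<le> (real CARD('n) - 2) + (e - 1) * (w \<bullet> c)"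
        by (simp add: inner_add_right algebra_simps)
      also have "\<dots> < (real CARD('n) - 2) + (e - 1) * (real CARD('n) - 2)"
        using cw[OF w] e(1) by simp
      also have "\<dots> = e * (real CARD('n) - 2)"
        by (simp add: algebra_simps)
      finally show ?thesis
        using e(1) by simp
    qed
    ultimately show "x \<in> ?O"
      using xT by (auto simp: T)
  qed
qed

text \<open>A minimal face containing the point will do: otherwise the point would lie on the relative boundary
and hence in a smaller face.\<close>

lemma polytope_in_rel_interior_face:
  fixes P :: "'a :: euclidean_space set"
  assumes "polytope P" "x \<in> P"
  obtains F where "F face_of P" "x \<in> rel_interior F"
proof -
  define C where "C = {F. F face_of P \<and> x \<in> F}"
  have "finite C"
    unfolding C_def by (rule finite_subset[OF _ finite_polytope_faces[OF assms(1)]]) auto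
  moreover have "P \<in> C"
    using assms by (auto simp: C_def face_of_refl polytope_imp_convex)
  ultimately obtain F where F: "F \<in> C" "\<And>G. G \<in> C \<Longrightarrow> G \<subseteq> F \<Longrightarrow> F = G"
    using finite_has_minimal[of C] by (metis empty_iff)
  have "x \<in> rel_interior F"
  proof (rule ccontr)
    assume "x \<notin> rel_interior F"
    then have "x \<in> rel_frontier F"
      using F(1) closure_subset by (auto simp: C_def rel_frontier_def)
    moreover have "polyhedron F"
      using F(1) assms(1) face_of_polyhedron_polyhedron polytope_imp_polyhedron by (auto simp: C_def)
    ultimately obtain G where "G face_of F" "G \<noteq> F" "x \<in> G"
      by (auto simp: rel_frontier_of_polyhedron_alt)
    then show False
      using F face_of_trans[of G F P] face_of_imp_subset[of G F] by (auto simp: C_def)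
  qed
  then show ?thesis
    using F(1) that by (auto simp: C_def)
qed

lemma interior_half_cube_nonempty:
  assumes "3 \<le> CARD('n)"
  shows "interior (half_cube :: (real ^ 'n) set) \<noteq> {}"
proof -
  let ?U = "{x :: real ^ 'n. (\<forall>i\<in>UNIV. \<bar>x $ i\<bar> < 1) \<and> (\<forall>w\<in>odd_sign_vectors. w \<bullet> x < real CARD('n) - 2)}"
  have "?U \<subseteq> half_cube"
    by (auto simp: half_cube_eq order_less_imp_le)
  then have "?U \<subseteq> interior half_cube"
    by (intro interior_maximal open_strict_half_cube)
  moreover have "0 \<in> ?U"
    using assms by auto
  ultimately show ?thesis by blast
qed

text \<open>The three kinds of cells are uniformly the relative interiors of the nonempty faces: a vertex is its
own relative interior, and the half cube, having interior points, is the only face of full dimension.\<close>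

lemma half_cube_cells_eq:
  assumes "3 \<le> CARD('n)"
  shows "half_cube_cells = rel_interior ` {F :: (real ^ 'n) set. F face_of half_cube \<and> F \<noteq> {}}"
proof
  have int: "rel_interior half_cube = interior (half_cube :: (real ^ 'n) set)"
    by (rule rel_interior_nonempty_interior[OF interior_half_cube_nonempty[OF assms]])
  have self: "half_cube face_of (half_cube :: (real ^ 'n) set)"
    by (rule face_of_refl[OF convex_half_cube])
  have ne: "half_cube \<noteq> ({} :: (real ^ 'n) set)"
    using interior_half_cube_nonempty[OF assms] by auto
  show "half_cube_cells \<subseteq> rel_interior ` {F :: (real ^ 'n) set. F face_of half_cube \<and> F \<noteq> {}}"
  proof
    fix e :: "(real ^ 'n) set"
    assume "e \<in> half_cube_cells"
    then consider x where "e = {x}" "x extreme_point_of half_cube"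
      | F where "e = rel_interior F" "F face_of half_cube" "0 < aff_dim F" | "e = interior half_cube"
      by (auto simp: half_cube_cells_def)
    then show "e \<in> rel_interior ` {F. F face_of half_cube \<and> F \<noteq> {}}"
    proof cases
      case 1
      then show ?thesis
        by (intro image_eqI[of _ _ "{x}"]) (auto simp: face_of_singleton)
    next
      case 2
      then show ?thesis
        by (intro image_eqI[of _ _ F]) auto
    next
      case 3
      then show ?thesis
        using int self ne by (intro image_eqI[of _ _ half_cube]) auto
    qed
  qed
  show "rel_interior ` {F :: (real ^ 'n) set. F face_of half_cube \<and> F \<noteq> {}} \<subseteq> half_cube_cells"
  proof
    fix e :: "(real ^ 'n) set"
    assume "e \<in> rel_interior ` {F. F face_of half_cube \<and> F \<noteq> {}}"
    then obtain F where F: "F face_of half_cube" "F \<noteq> {}" "e = rel_interior F"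
      by auto
    consider "aff_dim F = 0" | "0 < aff_dim F" "aff_dim F < int CARD('n)" | "aff_dim F = int CARD('n)"
      using aff_dim_geq[of F] aff_dim_le_DIM[of F] F(2) aff_dim_empty[of F] by fastforce
    then show "e \<in> half_cube_cells"
    proof cases
      case 1
      then obtain x where "F = {x}"
        using aff_dim_eq_0 by blast
      then show ?thesis
        using F by (auto simp: half_cube_cells_def face_of_singleton)
    next
      case 2
      then show ?thesis
        using F by (auto simp: half_cube_cells_def)
    next
      case 3
      then have "F = half_cube"
        using face_of_aff_dim_lt[OF convex_half_cube F(1)] aff_dim_le_DIM[of "half_cube :: (real ^ 'n) set"] by force
      then show ?thesis
        using F int by (auto simp: half_cube_cells_def)
    qed
  qed
qed

text \<open>The relative interiors of the faces partition the half cube, so removing some cells from the complex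
removes exactly their points.\<close>

lemma half_cube_complex_eq_Diff:
  assumes "3 \<le> k" "k \<le> CARD('n)"
  shows "half_cube_complex k =
    (half_cube :: (real ^ 'n) set) - (\<Union>v\<in>even_sign_vectors. \<Union>S\<in>{S. k \<le> card S}. rel_interior (convex hull L_set v S))"
proof -
  have n: "3 \<le> CARD('n)" using assms by simp
  have cl: "closure (rel_interior F) = F" if "F face_of half_cube" for F :: "(real ^ 'n) set"
    using that convex_closure_rel_interior[of F] face_of_imp_convex[of F] closure_closed[of F]
      face_of_imp_closed[OF convex_half_cube polytope_imp_closed[OF polytope_half_cube]] by metis
  have face: "convex hull L_set v S face_of half_cube" if "v \<in> even_sign_vectors" for v :: "real ^ 'n" and S
    using convex_hull_L_set[OF that] half_cube_face_of[OF that] by metis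
  show ?thesis
  proof (intro equalityI subsetI)
    fix x :: "real ^ 'n" assume "x \<in> half_cube_complex k"
    then obtain F where F: "F face_of half_cube" "x \<in> rel_interior F"
      "\<And>v S. v \<in> even_sign_vectors \<Longrightarrow> k \<le> card S \<Longrightarrow> closure (rel_interior F) \<noteq> convex hull L_set v S"
      by (auto simp: half_cube_complex_def half_cube_subcells_def half_cube_cells_eq[OF n])
    have "x \<notin> rel_interior (convex hull L_set v S)" if "v \<in> even_sign_vectors" "k \<le> card S" for v S
      using F(3)[OF that] face_of_eq[OF F(1) face[OF that(1), of S]] F(2) cl[OF F(1)] by blast
    moreover have "x \<in> half_cube"
      using F rel_interior_subset face_of_imp_subset by blast
    ultimately show "x \<in> half_cube - (\<Union>v\<in>even_sign_vectors. \<Union>S\<in>{S. k \<le> card S}. rel_interior (convex hull L_set v S))"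
      by auto
  next
    fix x :: "real ^ 'n"
    assume x: "x \<in> half_cube - (\<Union>v\<in>even_sign_vectors. \<Union>S\<in>{S. k \<le> card S}. rel_interior (convex hull L_set v S))"
    then obtain F where F: "F face_of half_cube" "x \<in> rel_interior F"
      using polytope_in_rel_interior_face[OF polytope_half_cube] by auto
    have "rel_interior F \<in> half_cube_subcells k"
      using F x cl[OF F(1)] by (auto simp: half_cube_subcells_def half_cube_cells_eq[OF n])
    then show "x \<in> half_cube_complex k"
      using F by (auto simp: half_cube_complex_def)
  qed
qed

text \<open>A free coordinate in \<open>S\<close> can be used to correct the parity.\<close>

lemma even_sign_vector_extending:
  fixes x :: "real ^ 'n"
  assumes "S \<noteq> {}" "\<And>i. i \<notin> S \<Longrightarrow> \<bar>x $ i\<bar> = 1"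
  obtains v where "v \<in> even_sign_vectors" "\<And>i. i \<notin> S \<Longrightarrow> v $ i = x $ i"
proof -
  obtain j where j: "j \<in> S" using assms by auto
  define u :: "real ^ 'n" where "u = (\<chi> i. if i \<in> S then 1 else x $ i)"
  have u: "\<forall>i. u $ i \<in> {1, -1}"
    using assms(2) by (auto simp: u_def abs_eq_iff')
  show ?thesis
  proof (cases "even (card {i. u $ i < 0})")
    case True
    show ?thesis
      by (rule that[of u]) (use True u in \<open>auto simp: even_sign_vectors_def u_def\<close>)
  next
    case False
    then have "u \<in> odd_sign_vectors"
      using u by (simp add: odd_sign_vectors_def)
    from odd_sign_vector_flip[OF this, of j] show ?thesis
      by (rule that) (use j in \<open>auto simp: u_def axis_def\<close>)
  qed
qed

text \<open>A point of the half cube on no cutting hyperplane lies in the relative interior of exactly one half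
cube shaped face, whose free coordinates are those strictly between \<open>-1\<close> and \<open>1\<close>.\<close>

lemma mem_half_cube_complex_iff:
  assumes "3 \<le> k" "k \<le> CARD('n)"
  shows "(x :: real ^ 'n) \<in> half_cube_complex k \<longleftrightarrow>
    (\<forall>i. \<bar>x $ i\<bar> \<le> 1) \<and> (\<forall>w\<in>odd_sign_vectors. w \<bullet> x \<le> real CARD('n) - 2) \<and>
    ((\<exists>w\<in>odd_sign_vectors. w \<bullet> x = real CARD('n) - 2) \<or> card {i. \<bar>x $ i\<bar> < 1} < k)"
proof (cases "x \<in> half_cube")
  case True
  then have le: "\<bar>x $ i\<bar> \<le> 1" for i
    by (auto simp: half_cube_eq)
  have wle: "w \<bullet> x \<le> real CARD('n) - 2" if "w \<in> odd_sign_vectors" for w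
    using True that by (auto simp: half_cube_eq)
  have "(\<exists>v\<in>even_sign_vectors. \<exists>S. k \<le> card S \<and> x \<in> rel_interior (convex hull L_set v S)) \<longleftrightarrow>
     (\<forall>w\<in>odd_sign_vectors. w \<bullet> x < real CARD('n) - 2) \<and> k \<le> card {i. \<bar>x $ i\<bar> < 1}"
  proof safe
    fix v :: "real ^ 'n" and S
    assume v: "v \<in> even_sign_vectors" "k \<le> card S" "x \<in> rel_interior (convex hull L_set v S)"
    then have *: "\<And>i. i \<in> S \<Longrightarrow> \<bar>x $ i\<bar> < 1" "\<And>w. w \<in> odd_sign_vectors \<Longrightarrow> w \<bullet> x < real CARD('n) - 2"
      using rel_interior_L_set[OF v(1), of S] assms by auto
    then have "card S \<le> card {i. \<bar>x $ i\<bar> < 1}"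
      by (intro card_mono) auto
    then show "k \<le> card {i. \<bar>x $ i\<bar> < 1}"
      using v by simp
    show "w \<bullet> x < real CARD('n) - 2" if "w \<in> odd_sign_vectors" for w
      using * that by blast
  next
    assume *: "\<forall>w\<in>odd_sign_vectors. w \<bullet> x < real CARD('n) - 2" and k: "k \<le> card {i. \<bar>x $ i\<bar> < 1}"
    define S where "S = {i. \<bar>x $ i\<bar> < 1}"
    have S3: "3 \<le> card S"
      using k assms by (simp add: S_def)
    then have "S \<noteq> {}" by auto
    moreover have "\<bar>x $ i\<bar> = 1" if "i \<notin> S" for i
      using that le[of i] by (auto simp: S_def)
    ultimately obtain v where v: "v \<in> even_sign_vectors" "\<And>i. i \<notin> S \<Longrightarrow> v $ i = x $ i"
      using even_sign_vector_extending by metis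
    have "x \<in> rel_interior (convex hull L_set v S)"
      using v * unfolding rel_interior_L_set[OF v(1) S3] by (auto simp: S_def)
    then show "\<exists>v\<in>even_sign_vectors. \<exists>S. k \<le> card S \<and> x \<in> rel_interior (convex hull L_set v S)"
      using v k S_def by blast
  qed
  then show ?thesis
    using True le wle unfolding half_cube_complex_eq_Diff[OF assms]
    by (auto simp: order_less_le not_le dest: spec)
next
  case False
  then show ?thesis
    unfolding half_cube_complex_eq_Diff[OF assms] by (auto simp: half_cube_eq)
qed

section \<open>From the complex to the complement of the coordinate subspaces\<close>

lemma continuous_on_Max [continuous_intros]:
  fixes f :: "'a \<Rightarrow> 'b :: topological_space \<Rightarrow> real"
  assumes "finite A" "A \<noteq> {}" "\<And>a. a \<in> A \<Longrightarrow> continuous_on S (f a)"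
  shows "continuous_on S (\<lambda>x. Max ((\<lambda>a. f a x) ` A))"
  using assms
proof (induction rule: finite_ne_induct)
  case (insert a A)
  then show ?case
    by (simp add: continuous_on_max)
qed simp

lemma continuous_on_Min [continuous_intros]:
  fixes f :: "'a \<Rightarrow> 'b :: topological_space \<Rightarrow> real"
  assumes "finite A" "A \<noteq> {}" "\<And>a. a \<in> A \<Longrightarrow> continuous_on S (f a)"
  shows "continuous_on S (\<lambda>x. Min ((\<lambda>a. f a x) ` A))"
  using assms
proof (induction rule: finite_ne_induct)
  case (insert a A)
  then show ?case
    by (simp add: continuous_on_min)
qed simp

text \<open>The \<open>k\<close>-th smallest of the numbers \<open>|x\<^sub>i|\<close>, in a form from which continuity is immediate.\<close>

definition kth_abs :: "nat \<Rightarrow> real ^ 'n \<Rightarrow> real" where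
  "kth_abs k x = Min ((\<lambda>S. Max ((\<lambda>i. \<bar>x $ i\<bar>) ` S)) ` {S. card S = k})"

lemma exists_subset_card:
  assumes "k \<le> CARD('n::finite)"
  shows "{S :: 'n set. card S = k} \<noteq> {}"
  using obtain_subset_with_card_n[OF assms] by blast

lemma card_positive_set: "0 < k \<Longrightarrow> card S = k \<Longrightarrow> S \<noteq> {}"
  by auto

lemma card_less_iff_no_subset:
  fixes A :: "'n::finite set"
  shows "card A < k \<longleftrightarrow> (\<forall>S\<in>{S. card S = k}. \<exists>i\<in>S. i \<notin> A)"
proof
  assume k: "card A < k"
  have "\<not> S \<subseteq> A" if "card S = k" for S
    using card_mono[of A S] that k by auto
  then show "\<forall>S\<in>{S. card S = k}. \<exists>i\<in>S. i \<notin> A"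
    by blast
next
  assume *: "\<forall>S\<in>{S. card S = k}. \<exists>i\<in>S. i \<notin> A"
  show "card A < k"
  proof (rule ccontr)
    assume "\<not> card A < k"
    then obtain S where "S \<subseteq> A" "card S = k"
      by (meson not_less obtain_subset_with_card_n)
    then show False using * by blast
  qed
qed

lemma le_kth_abs_iff:
  fixes x :: "real ^ 'n"
  assumes "0 < k" "k \<le> CARD('n)"
  shows "c \<le> kth_abs k x \<longleftrightarrow> card {i. \<bar>x $ i\<bar> < c} < k"
proof -
  have "c \<le> Max ((\<lambda>i. \<bar>x $ i\<bar>) ` S) \<longleftrightarrow> (\<exists>i\<in>S. c \<le> \<bar>x $ i\<bar>)" if "card S = k" for S
    using card_positive_set[OF assms(1) that] by (subst Max_ge_iff) auto
  then have "c \<le> kth_abs k x \<longleftrightarrow> (\<forall>S\<in>{S. card S = k}. \<exists>i\<in>S. c \<le> \<bar>x $ i\<bar>)"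
    unfolding kth_abs_def using exists_subset_card[OF assms(2)] by (subst Min_ge_iff) auto
  then show ?thesis
    unfolding card_less_iff_no_subset by (simp add: not_less)
qed

lemma less_kth_abs_iff:
  fixes x :: "real ^ 'n"
  assumes "0 < k" "k \<le> CARD('n)"
  shows "c < kth_abs k x \<longleftrightarrow> card {i. \<bar>x $ i\<bar> \<le> c} < k"
proof -
  have "c < Max ((\<lambda>i. \<bar>x $ i\<bar>) ` S) \<longleftrightarrow> (\<exists>i\<in>S. c < \<bar>x $ i\<bar>)" if "card S = k" for S
    using card_positive_set[OF assms(1) that] by (subst Max_gr_iff) auto
  then have "c < kth_abs k x \<longleftrightarrow> (\<forall>S\<in>{S. card S = k}. \<exists>i\<in>S. c < \<bar>x $ i\<bar>)"
    unfolding kth_abs_def using exists_subset_card[OF assms(2)] by (subst Min_gr_iff) auto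
  then show ?thesis
    unfolding card_less_iff_no_subset by (simp add: not_le)
qed

lemma few_zeros_iff_kth_abs:
  fixes x :: "real ^ 'n"
  assumes "0 < k" "k \<le> CARD('n)"
  shows "x \<in> few_zeros UNIV k \<longleftrightarrow> 0 < kth_abs k x"
  by (simp add: less_kth_abs_iff[OF assms] few_zeros_def)

lemma continuous_on_kth_abs:
  assumes "0 < k" "k \<le> CARD('n)"
  shows "continuous_on T (kth_abs k :: real ^ 'n \<Rightarrow> real)"
proof -
  have "continuous_on T (\<lambda>x :: real ^ 'n. Min ((\<lambda>S. Max ((\<lambda>i. \<bar>x $ i\<bar>) ` S)) ` {S. card S = k}))"
    using exists_subset_card[OF assms(2)] card_positive_set[OF assms(1)]
    by (intro continuous_on_Min continuous_on_Max continuous_intros) auto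
  then show ?thesis
    by (simp add: kth_abs_def[abs_def])
qed

definition to_cube :: "real ^ 'n \<Rightarrow> real ^ 'n" where
  "to_cube x = (\<chi> i. max (-1) (min 1 (x $ i)))"

lemma to_cube_nth [simp]: "to_cube x $ i = max (-1) (min 1 (x $ i))"
  by (simp add: to_cube_def)

lemma continuous_on_to_cube [continuous_intros]:
  "continuous_on S f \<Longrightarrow> continuous_on S (\<lambda>x. to_cube (f x))"
  unfolding to_cube_def
  by (intro continuous_on_vec_lambda continuous_on_max continuous_on_min continuous_intros)

text \<open>A point of the cube is in the half cube iff its corner height is at most \<open>n - 2\<close>.\<close>

definition corner_height :: "real ^ 'n \<Rightarrow> real" where
  "corner_height x = Max ((\<lambda>w. w \<bullet> x) ` odd_sign_vectors)"

lemma odd_sign_vectors_nonempty: "odd_sign_vectors \<noteq> ({} :: (real ^ 'n) set)"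
proof -
  have "(\<chi> i. 1) \<in> (even_sign_vectors :: (real ^ 'n) set)"
    by (simp add: even_sign_vectors_def)
  from even_sign_vector_flip[OF this] show ?thesis by blast
qed

lemma inner_le_corner_height: "w \<in> odd_sign_vectors \<Longrightarrow> w \<bullet> x \<le> corner_height x"
  by (simp add: corner_height_def finite_odd_sign_vectors)

lemma corner_height_attained:
  obtains w where "w \<in> odd_sign_vectors" "w \<bullet> x = corner_height x"
proof -
  have "corner_height x \<in> (\<lambda>w. w \<bullet> x) ` odd_sign_vectors"
    unfolding corner_height_def
    using finite_odd_sign_vectors odd_sign_vectors_nonempty by (intro Max_in) auto
  then show ?thesis using that by auto
qed

lemma corner_height_le_iff: "corner_height x \<le> c \<longleftrightarrow> (\<forall>w\<in>odd_sign_vectors. w \<bullet> x \<le> c)"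
  by (simp add: corner_height_def finite_odd_sign_vectors odd_sign_vectors_nonempty)

lemma continuous_on_corner_height: "continuous_on T corner_height"
proof -
  have "continuous_on T (\<lambda>x. Max ((\<lambda>w. w \<bullet> x) ` odd_sign_vectors))"
    using finite_odd_sign_vectors odd_sign_vectors_nonempty
    by (intro continuous_on_Max continuous_intros) auto
  then show ?thesis
    by (simp add: corner_height_def[abs_def])
qed

text \<open>Shrinks the points beyond a cutting hyperplane radially towards the origin onto that hyperplane and
leaves the half cube fixed.\<close>

definition cut_corners :: "real ^ 'n \<Rightarrow> real ^ 'n" where
  "cut_corners x = ((real CARD('n) - 2) / max (real CARD('n) - 2) (corner_height x)) *\<^sub>R x"

lemma continuous_on_cut_corners:
  assumes "3 \<le> CARD('n)"
  shows "continuous_on T (cut_corners :: real ^ 'n \<Rightarrow> real ^ 'n)"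
  unfolding cut_corners_def[abs_def] using assms
  by (intro continuous_intros continuous_on_max continuous_on_corner_height) auto

lemma mem_half_cube_complex_iff_corner_height:
  assumes "3 \<le> k" "k \<le> CARD('n)"
  shows "(x :: real ^ 'n) \<in> half_cube_complex k \<longleftrightarrow>
    (\<forall>i. \<bar>x $ i\<bar> \<le> 1) \<and> corner_height x \<le> real CARD('n) - 2 \<and>
    (corner_height x = real CARD('n) - 2 \<or> card {i. \<bar>x $ i\<bar> < 1} < k)"
proof -
  obtain w where "w \<in> odd_sign_vectors" "w \<bullet> x = corner_height x"
    by (rule corner_height_attained)
  then show ?thesis
    unfolding mem_half_cube_complex_iff[OF assms] corner_height_le_iff[symmetric]
    using inner_le_corner_height[of _ x] by (metis order_antisym)
qed

text \<open>If the scaling factor is not \<open>1\<close>, the image lies on a cutting hyperplane, because the corner height is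
positively homogeneous; otherwise nothing moves.\<close>

lemma cut_corners_in_complex:
  fixes y :: "real ^ 'n"
  assumes k: "3 \<le> k" "k \<le> CARD('n)" and y: "\<And>i. \<bar>y $ i\<bar> \<le> 1"
    and "real CARD('n) - 2 \<le> corner_height y \<or> card {i. \<bar>y $ i\<bar> < 1} < k"
  shows "cut_corners y \<in> half_cube_complex k"
proof (cases "corner_height y \<le> real CARD('n) - 2")
  case True
  then have "cut_corners y = y"
    using k by (simp add: cut_corners_def max_absorb1)
  then show ?thesis
    using assms True by (auto simp: mem_half_cube_complex_iff_corner_height)
next
  case False
  define c where "c = (real CARD('n) - 2) / corner_height y"
  have c: "0 < c" "c \<le> 1" "c * corner_height y = real CARD('n) - 2"
    using False k by (auto simp: c_def)
  have eq: "cut_corners y = c *\<^sub>R y"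
    using False by (simp add: cut_corners_def c_def max_absorb2)
  have "corner_height (c *\<^sub>R y) = c * corner_height y"
  proof (rule antisym)
    show "corner_height (c *\<^sub>R y) \<le> c * corner_height y"
      unfolding corner_height_le_iff inner_scaleR_right
      using c by (intro ballI mult_left_mono inner_le_corner_height) auto
    obtain w where "w \<in> odd_sign_vectors" "w \<bullet> y = corner_height y"
      by (rule corner_height_attained)
    then show "c * corner_height y \<le> corner_height (c *\<^sub>R y)"
      using inner_le_corner_height[of w "c *\<^sub>R y"] by simp
  qed
  moreover have "\<bar>(c *\<^sub>R y) $ i\<bar> \<le> 1" for i
    using c y[of i] by (simp add: abs_mult mult_le_one)
  ultimately show ?thesis
    using k c unfolding eq by (simp add: mem_half_cube_complex_iff_corner_height)
qed

lemma cut_corners_id: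
  fixes x :: "real ^ 'n"
  assumes "3 \<le> k" "k \<le> CARD('n)" "x \<in> half_cube_complex k"
  shows "cut_corners x = x"
  using assms by (simp add: cut_corners_def mem_half_cube_complex_iff_corner_height max_absorb1)

lemma to_cube_id: "(\<And>i. \<bar>x $ i\<bar> \<le> 1) \<Longrightarrow> to_cube x = x"
  by (auto simp: vec_eq_iff abs_le_iff minus_le_iff max_def min_def)
     (smt (verit))+

text \<open>The numbers \<open>1 - u\<^sub>i\<close> are nonnegative with sum \<open>2\<close>.  If all \<open>u\<^sub>i\<close> are nonnegative, scaling and clamping
decreases none of them.  Otherwise there is one negative entry \<open>u\<^sub>j = - a\<close>, and all other entries are
at least \<open>a\<close>, because any two of the numbers \<open>1 - u\<^sub>i\<close> have sum at most \<open>2\<close>.  What is lost at \<open>j\<close> is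
then compensated at any single entry that has not yet been clamped; and if there is none, the sum is at
least \<open>(n - 1) - 1\<close>.\<close>

lemma sum_clamp_scaled:
  fixes u :: "'n::finite \<Rightarrow> real"
  assumes u: "\<And>i. \<bar>u i\<bar> \<le> 1" and sum: "(\<Sum>i\<in>UNIV. u i) = real CARD('n) - 2" and s: "1 \<le> s"
  shows "real CARD('n) - 2 \<le> (\<Sum>i\<in>UNIV. max (-1) (min 1 (s * u i)))"
proof -
  have ge: "u i \<le> max (-1) (min 1 (s * u i))" if "0 \<le> u i" for i
  proof -
    have "1 * u i \<le> s * u i"
      using that s by (intro mult_right_mono)
    then show ?thesis
      using u[of i] by auto
  qed
  show ?thesis
  proof (cases "\<exists>j. u j < 0")
    case False
    then have "(\<Sum>i\<in>UNIV. u i) \<le> (\<Sum>i\<in>UNIV. max (-1) (min 1 (s * u i)))"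
      by (intro sum_mono ge) (simp add: not_less)
    then show ?thesis using sum by simp
  next
    case True
    then obtain j where j: "u j < 0" by auto
    define a where "a = - u j"
    have a: "0 < a" using j by (simp add: a_def)
    have other: "a \<le> u i" if "i \<noteq> j" for i
    proof -
      have "(\<Sum>l\<in>{i, j}. 1 - u l) \<le> (\<Sum>l\<in>UNIV. 1 - u l)"
        using u by (intro sum_mono2) (auto simp: abs_le_iff)
      also have "\<dots> = 2"
        using sum by (simp add: sum_subtractf)
      finally show ?thesis
        using that by (simp add: a_def)
    qed
    have split: "(\<Sum>i\<in>UNIV. max (-1) (min 1 (s * u i)))
        = max (-1) (- s * a) + (\<Sum>i\<in>UNIV - {j}. max (-1) (min 1 (s * u i)))"
    proof -
      have "s * u j \<le> 0"
        using j s by (simp add: mult_nonneg_nonpos)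
      then show ?thesis
        by (subst sum.remove[of UNIV j]) (auto simp: a_def min_def)
    qed
    show ?thesis
    proof (cases "\<exists>i. i \<noteq> j \<and> s * u i < 1")
      case False
      then have "(\<Sum>i\<in>UNIV - {j}. max (-1) (min 1 (s * u i))) = (\<Sum>i\<in>UNIV - {j}. 1)"
        by (intro sum.cong) (auto simp: not_less)
      then show ?thesis
        unfolding split by (simp add: of_nat_diff)
    next
      case True
      then obtain i where i: "i \<noteq> j" "s * u i < 1" by auto
      have "s * u i = u i + (s - 1) * u i"
        by (simp add: algebra_simps)
      moreover have "(s - 1) * a \<le> (s - 1) * u i"
        using other[OF i(1)] s by (intro mult_left_mono) auto
      ultimately have ui: "u i + (s - 1) * a \<le> max (-1) (min 1 (s * u i))"
        using i by simp
      have "(\<Sum>l\<in>UNIV - {j} - {i}. u l) \<le> (\<Sum>l\<in>UNIV - {j} - {i}. max (-1) (min 1 (s * u l)))"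
        using other a by (intro sum_mono ge) force
      moreover have "(\<Sum>l\<in>UNIV - {j}. max (-1) (min 1 (s * u l)))
          = max (-1) (min 1 (s * u i)) + (\<Sum>l\<in>UNIV - {j} - {i}. max (-1) (min 1 (s * u l)))"
        using i by (intro sum.remove) auto
      moreover have "(\<Sum>l\<in>UNIV. u l) = - a + (u i + (\<Sum>l\<in>UNIV - {j} - {i}. u l))"
        using i by (simp add: a_def sum.remove[of UNIV j] sum.remove[of "UNIV - {j}" i])
      moreover have "- s * a \<le> max (-1) (- s * a)"
        by simp
      ultimately show ?thesis
        using ui sum unfolding split by (simp add: algebra_simps)
    qed
  qed
qed

text \<open>Scaling up a point of a cut facet and clamping it into the cube never leads back below the cutting
hyperplane; the coordinates \<open>w\<^sub>i x\<^sub>i\<close> reduce this to the case of the corner \<open>(1, \<dots>, 1)\<close>.\<close>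

lemma corner_height_to_cube_scaled:
  fixes x :: "real ^ 'n"
  assumes x: "\<And>i. \<bar>x $ i\<bar> \<le> 1" and ch: "corner_height x = real CARD('n) - 2" and s: "1 \<le> s"
  shows "real CARD('n) - 2 \<le> corner_height (to_cube (s *\<^sub>R x))"
proof -
  obtain w where w: "w \<in> odd_sign_vectors" "w \<bullet> x = real CARD('n) - 2"
    using corner_height_attained[of x] ch by metis
  have "real CARD('n) - 2 \<le> (\<Sum>i\<in>UNIV. max (-1) (min 1 (s * (w $ i * x $ i))))"
    using w x odd_sign_vectors_nth[OF w(1)] s
    by (intro sum_clamp_scaled) (auto simp: inner_vec_real abs_mult, metis abs_minus_cancel abs_one mult_1)
  also have "\<dots> = w \<bullet> to_cube (s *\<^sub>R x)"
  proof -
    have "max (-1) (min 1 (s * (w $ i * x $ i))) = w $ i * to_cube (s *\<^sub>R x) $ i" for i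
      using odd_sign_vectors_nth[OF w(1), of i] by (auto simp: max_def min_def)
    then show ?thesis
      by (simp add: inner_vec_real)
  qed
  also have "\<dots> \<le> corner_height (to_cube (s *\<^sub>R x))"
    by (rule inner_le_corner_height[OF w(1)])
  finally show ?thesis .
qed

text \<open>On a cutting hyperplane the numbers \<open>1 - w\<^sub>i x\<^sub>i\<close> have sum \<open>2\<close>, and each zero coordinate contributes \<open>1\<close>,
so there are at most two of them, fewer than \<open>k\<close>.\<close>

lemma half_cube_complex_subset_few_zeros:
  assumes k: "3 \<le> k" "k \<le> CARD('n)"
  shows "half_cube_complex k \<subseteq> (few_zeros UNIV k :: (real ^ 'n) set)"
proof
  fix x :: "real ^ 'n" assume "x \<in> half_cube_complex k"
  then have x: "\<And>i. \<bar>x $ i\<bar> \<le> 1"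
    and alt: "(\<exists>w\<in>odd_sign_vectors. w \<bullet> x = real CARD('n) - 2) \<or> card {i. \<bar>x $ i\<bar> < 1} < k"
    by (auto simp: mem_half_cube_complex_iff[OF k])
  let ?Z = "{i. x $ i = 0}"
  from alt have "card ?Z < k"
  proof
    assume "card {i. \<bar>x $ i\<bar> < 1} < k"
    moreover have "card ?Z \<le> card {i. \<bar>x $ i\<bar> < 1}"
      by (intro card_mono) auto
    ultimately show ?thesis by simp
  next
    assume "\<exists>w\<in>odd_sign_vectors. w \<bullet> x = real CARD('n) - 2"
    then obtain w where w: "w \<in> odd_sign_vectors" "w \<bullet> x = real CARD('n) - 2" by auto
    have "real (card ?Z) = (\<Sum>i\<in>?Z. 1 - w $ i * x $ i)"
      by simp
    also have "\<dots> \<le> (\<Sum>i\<in>UNIV. 1 - w $ i * x $ i)"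
      using sign_vector_mult_le_1[OF w(1) x] by (intro sum_mono2) auto
    also have "\<dots> = 2"
      using w(2) by (simp add: inner_vec_real sum_subtractf)
    finally show ?thesis
      using k by simp
  qed
  then show "x \<in> few_zeros UNIV k"
    by (simp add: few_zeros_def)
qed

lemma homotopic_with_top_of_setI:
  fixes h :: "real \<Rightarrow> 'a :: topological_space \<Rightarrow> 'b :: topological_space"
  assumes "continuous_on ({0..1} \<times> S) (\<lambda>(t, x). h t x)"
    and "\<And>t x. 0 \<le> t \<Longrightarrow> t \<le> 1 \<Longrightarrow> x \<in> S \<Longrightarrow> h t x \<in> T"
    and "\<And>x. x \<in> S \<Longrightarrow> h 0 x = f x" and "\<And>x. x \<in> S \<Longrightarrow> h 1 x = g x"
  shows "homotopic_with (\<lambda>_. True) (top_of_set S) (top_of_set T) f g"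
proof -
  have "homotopic_with (\<lambda>_. True) (top_of_set S) (top_of_set T) (h 0) (h 1)"
    unfolding homotopic_with_def
    by (rule exI[of _ "\<lambda>(t, x). h t x"]) (use assms(1,2) in auto)
  then show ?thesis
    by (rule homotopic_with_eq) (use assms(3,4) in auto)
qed

text \<open>The homotopy inverse \<open>p\<close> of the inclusion scales \<open>x\<close> so that its \<open>k\<close>-th smallest absolute value
becomes \<open>1\<close>, clamps it to the cube, which leads to a point of the \<open>(k-1)\<close>-skeleton of the cube, and
cuts the odd corners off.  Since \<open>p\<close> preserves the signs of all coordinates, the straight segment from
\<open>p x\<close> to \<open>x\<close> creates no new zeros.  On the complex itself, the same construction with a scaling factor
growing from \<open>1\<close> to its final value is a homotopy from the identity to \<open>p\<close>; it stays in the complex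
because clamped coordinates remain clamped and points of a cut facet remain on or beyond its hyperplane.\<close>

lemma half_cube_complex_homotopy_equivalent:
  assumes k: "3 \<le> k" "k \<le> CARD('n)"
  shows "top_of_set (half_cube_complex k :: (real ^ 'n) set)
    homotopy_equivalent_space top_of_set (few_zeros UNIV k :: (real ^ 'n) set)"
proof -
  define C W where "C = (half_cube_complex k :: (real ^ 'n) set)" and "W = (few_zeros UNIV k :: (real ^ 'n) set)"
  define p :: "real ^ 'n \<Rightarrow> real ^ 'n"
    where "p x = cut_corners (to_cube (inverse (kth_abs k x) *\<^sub>R x))" for x
  have k0: "0 < k" and n3: "3 \<le> CARD('n)" using k by auto
  note mu = le_kth_abs_iff[OF k0 k(2)] less_kth_abs_iff[OF k0 k(2)] few_zeros_iff_kth_abs[OF k0 k(2)]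
  note comp = continuous_on_compose2[OF continuous_on_cut_corners[OF n3] _ subset_UNIV]
    continuous_on_compose2[OF continuous_on_kth_abs[OF k0 k(2)] _ subset_UNIV]
  have CW: "C \<subseteq> W"
    unfolding C_def W_def by (rule half_cube_complex_subset_few_zeros[OF k])
  have Wpos: "0 < kth_abs k x" if "x \<in> W" for x
    using that mu(3) by (simp add: W_def)
  have cut_in: "cut_corners (to_cube y) \<in> C"
    if "real CARD('n) - 2 \<le> corner_height (to_cube y) \<or> card {i. \<bar>y $ i\<bar> < 1} < k" for y
  proof -
    have "{i. \<bar>to_cube y $ i\<bar> < 1} = {i. \<bar>y $ i\<bar> < 1}"
      by (auto simp: max_def min_def)
    then show ?thesis
      unfolding C_def by (intro cut_corners_in_complex k) (use that in \<open>auto simp: abs_le_iff\<close>)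
  qed
  have pC: "p x \<in> C" if x: "x \<in> W" for x
  proof -
    have "{i. \<bar>(inverse (kth_abs k x) *\<^sub>R x) $ i\<bar> < 1} = {i. \<bar>x $ i\<bar> < kth_abs k x}"
      using Wpos[OF x] by (auto simp: abs_mult field_simps)
    moreover have "card {i. \<bar>x $ i\<bar> < kth_abs k x} < k"
      using mu(1)[of "kth_abs k x" x] by simp
    ultimately show ?thesis
      unfolding p_def by (intro cut_in) simp
  qed
  have contp: "continuous_on W p"
    unfolding p_def using Wpos by (intro comp continuous_intros) force+
  have "homotopic_with (\<lambda>_. True) (top_of_set C) (top_of_set C) (p \<circ> id) id"
  proof (rule homotopic_with_top_of_setI)
    let ?h = "\<lambda>t x. cut_corners (to_cube (inverse ((1 - t) * kth_abs k x + t) *\<^sub>R x))"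
    have pos: "0 < (1 - t) * kth_abs k x + t" if t: "0 \<le> t" "t \<le> 1" and x: "x \<in> C" for t x
    proof (cases "t = 0")
      case True
      then show ?thesis using Wpos CW x by auto
    next
      case False
      have "0 \<le> (1 - t) * kth_abs k x"
        using t Wpos[of x] CW x by (intro mult_nonneg_nonneg) auto
      then show ?thesis using t False by linarith
    qed
    show "continuous_on ({0..1} \<times> C) (\<lambda>(t, x). ?h t x)"
      unfolding case_prod_unfold using pos by (intro comp continuous_intros) force+
    show "?h t x \<in> C" if t: "0 \<le> t" "t \<le> 1" and x: "x \<in> C" for t x
    proof -
      have le: "\<bar>x $ i\<bar> \<le> 1" for i
        using x by (simp add: C_def mem_half_cube_complex_iff[OF k])
      then have "kth_abs k x \<le> 1"
        using mu(2)[of 1 x] k by (simp add: not_less[symmetric])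
      then have "(1 - t) * kth_abs k x + t \<le> (1 - t) * 1 + t"
        using t by (intro add_mono mult_left_mono) auto
      then have s: "1 \<le> inverse ((1 - t) * kth_abs k x + t)" (is "1 \<le> ?s")
        using pos[OF t x] by (simp add: one_le_inverse)
      have "corner_height x = real CARD('n) - 2 \<or> card {i. \<bar>x $ i\<bar> < 1} < k"
        using x by (simp add: C_def mem_half_cube_complex_iff_corner_height[OF k])
      then show ?thesis
      proof
        assume "corner_height x = real CARD('n) - 2"
        then show ?thesis
          using corner_height_to_cube_scaled[OF le _ s] by (intro cut_in) simp
      next
        assume "card {i. \<bar>x $ i\<bar> < 1} < k"
        moreover have "card {i. \<bar>(?s *\<^sub>R x) $ i\<bar> < 1} \<le> card {i. \<bar>x $ i\<bar> < 1}"
        proof (intro card_mono subsetI)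
          fix i assume "i \<in> {i. \<bar>(?s *\<^sub>R x) $ i\<bar> < 1}"
          moreover have "1 * \<bar>x $ i\<bar> \<le> ?s * \<bar>x $ i\<bar>"
            using s by (intro mult_right_mono) auto
          ultimately show "i \<in> {i. \<bar>x $ i\<bar> < 1}"
            using pos[OF t x] by (simp add: abs_mult)
        qed auto
        ultimately show ?thesis
          by (intro cut_in) simp
      qed
    qed
    show "?h 0 x = (p \<circ> id) x" for x
      by (simp add: p_def)
    show "?h 1 x = id x" if "x \<in> C" for x
      using that cut_corners_id[OF k] by (simp add: C_def to_cube_id mem_half_cube_complex_iff[OF k])
  qed
  moreover have "homotopic_with (\<lambda>_. True) (top_of_set W) (top_of_set W) (id \<circ> p) id"
  proof (rule homotopic_with_top_of_setI)
    let ?h = "\<lambda>t x. (1 - t) *\<^sub>R p x + t *\<^sub>R x"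
    show "continuous_on ({0..1} \<times> W) (\<lambda>(t, x). ?h t x)"
      unfolding case_prod_unfold
      by (intro continuous_intros continuous_on_compose2[OF contp]) auto
    show "?h t x \<in> W" if t: "0 \<le> t" "t \<le> 1" and x: "x \<in> W" for t x
    proof -
      obtain c where c: "0 < c" "\<And>i. p x $ i = c * to_cube (inverse (kth_abs k x) *\<^sub>R x) $ i"
      proof
        show "0 < (real CARD('n) - 2) / max (real CARD('n) - 2)
            (corner_height (to_cube (inverse (kth_abs k x) *\<^sub>R x)))"
          using n3 by (intro divide_pos_pos) auto
      qed (simp add: p_def cut_corners_def)
      have pos: "0 < ?h t x $ i" if "0 < x $ i" for i
      proof -
        have "0 < p x $ i"
          using c(1) Wpos[OF x] that unfolding c(2) by (intro mult_pos_pos) (auto simp: less_max_iff_disj)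
        then show ?thesis
          using that t by (cases "t = 0") (auto intro!: add_nonneg_pos)
      qed
      have neg: "?h t x $ i < 0" if "x $ i < 0" for i
      proof -
        have "p x $ i < 0"
          using c(1) Wpos[OF x] that unfolding c(2)
          by (intro mult_pos_neg) (auto simp: min_less_iff_disj mult_pos_neg)
        then show ?thesis
          using that t by (cases "t = 0") (auto intro!: add_nonpos_neg simp: mult_pos_neg mult_nonneg_nonpos)
      qed
      have "card {i. ?h t x $ i = 0} \<le> card {i. x $ i = 0}"
        using pos neg by (intro card_mono) (auto, metis less_irrefl linorder_neqE_linordered_idom)
      then show ?thesis
        using x by (simp add: W_def few_zeros_def)
    qed
  qed auto
  ultimately have "top_of_set C homotopy_equivalent_space top_of_set W"
    unfolding homotopy_equivalent_space_def
    using CW contp pC by (intro exI[of _ id] exI[of _ p]) auto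
  then show ?thesis
    by (simp add: C_def W_def)
qed


section \<open>The rank formula\<close>

text \<open>Pascal's rule turns the alternating sum into the same recurrence; the initial value for \<open>k = 0\<close> is
\<open>(-1 + 2)\<^sup>m = 1\<close>.\<close>

lemma skeleton_rank_eq:
  "int (skeleton_rank m k) = (\<Sum>i = k..m. (-1) ^ (k + i) * 2 ^ (m - i) * int (m choose i))"
proof (induction m k rule: skeleton_rank.induct)
  case (1 m)
  have "(1 :: int) = (-1 + 2) ^ m"
    by simp
  also have "\<dots> = (\<Sum>i\<le>m. int (m choose i) * (-1) ^ i * 2 ^ (m - i))"
    unfolding binomial_ring ..
  finally show ?case
    by (simp add: atLeast0AtMost mult_ac)
next
  case (3 m k)
  let ?f = "\<lambda>i. (-1) ^ (Suc k + i) * 2 ^ (Suc m - i) * int (m choose i)"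
  have "(\<Sum>i = Suc k..Suc m. (-1) ^ (Suc k + i) * 2 ^ (Suc m - i) * int (Suc m choose i))
     = (\<Sum>i = k..m. (-1) ^ (k + i) * 2 ^ (m - i) * int (m choose i) + ?f (Suc i))"
    unfolding sum.shift_bounds_cl_Suc_ivl
    by (intro sum.cong) (auto simp: algebra_simps)
  also have "\<dots> = int (skeleton_rank m k) + (\<Sum>i = k..m. ?f (Suc i))"
    by (simp add: sum.distrib 3)
  also have "(\<Sum>i = k..m. ?f (Suc i)) = (\<Sum>i = Suc k..Suc m. ?f i)"
    by (simp only: sum.shift_bounds_cl_Suc_ivl)
  also have "\<dots> = (\<Sum>i = Suc k..m. ?f i)"
    by (intro sum.mono_neutral_right) (auto simp: not_le binomial_eq_0)
  also have "\<dots> = 2 * int (skeleton_rank m (Suc k))"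
    unfolding 3 sum_distrib_left by (intro sum.cong) (auto simp: Suc_diff_le)
  finally show ?case
    by simp
qed simp

theorem theorem4p1p2:
  fixes k :: nat
  assumes "CARD('n::finite) \<ge> 4" and "3 \<le> k" and "k \<le> CARD('n)"
  shows "\<exists>r :: nat.
    abelian_group_rank
      (homology_group (int k - 1) (top_of_set (half_cube_complex k :: (real ^ 'n) set))) = enat r \<and>
    int r = (\<Sum>i = k..CARD('n). (-1) ^ (k + i) * 2 ^ (CARD('n) - i) * int (CARD('n) choose i))"
proof (intro exI conjI)
  let ?C = "top_of_set (half_cube_complex k :: (real ^ 'n) set)"
  let ?W = "few_zeros UNIV k :: (real ^ 'n) set"
  have "(\<chi> i. 1) \<in> ?W"
    using assms by (simp add: few_zeros_def)
  then have "homology_group (int k - 1) (top_of_set ?W) \<cong> relative_homology_group (int k - 1 + 1) euclidean ?W"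
    using assms by (intro iso_homology_contractible_space_subtopology2 contractible_space_euclidean_vec) auto
  moreover have "homology_group (int k - 1) ?C \<cong> homology_group (int k - 1) (top_of_set ?W)"
    by (intro homotopy_equivalent_space_imp_isomorphic_homology_groups
          half_cube_complex_homotopy_equivalent assms)
  ultimately have "relative_homology_group (int k) euclidean ?W \<cong> homology_group (int k - 1) ?C"
    using iso_trans iso_sym_homology by fastforce
  moreover have "abelian_group_rank (relative_homology_group (int k) euclidean ?W)
      = enat (skeleton_rank CARD('n) k)"
    using relative_homology_few_zeros[of k UNIV] by blast
  ultimately show "abelian_group_rank (homology_group (int k - 1) ?C) = enat (skeleton_rank CARD('n) k)"
    using abelian_group_rank_iso abelian_relative_homology_group by blast
qed (rule skeleton_rank_eq)

end
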